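(* Let $M$ be a special Kähler manifold of real dimension $2n$, described locally by flat coordinates $x_1,\dots,x_{2n}$ that are symplectic, $\omega=\sum_{j=1}^n dx_j\wedge dx_{n+j}$, and a function $\phi(x_1,\dots,x_{2n})$ such that the metric is $\sum\frac{\partial^2\phi}{\partial x_j\partial x_k}dx_jdx_k$. Let $\mathcal F$ be a corresponding holomorphic prepotential. Then the hyperkähler metric on $M\times\mathbf{R}^{2n}$ (coordinates $y_1,\dots,y_{2n}$ on $\mathbf{R}^{2n}$) defined by the symplectic forms $$\omega_1=\sum_{j,k}\frac{\partial^2\phi}{\partial x_j\partial x_k}dx_j\wedge dy_k,\qquad \omega_2+i\omega_3=-\frac12\sum_{j,k}\omega_{jk}\,d(x_j+iy_j)\wedge d(x_k+iy_k)$$ is constructed by the Legendre transform method from the function $F=\operatorname{Re}\mathcal F$.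
   Context: Special Kähler structure: a complex manifold $(M,I)$ with Kähler metric $g$, Kähler form $\omega$, and flat torsion-free connection $\nabla$ with $\nabla\omega=0$ and $d_\nabla I=0\in\Omega^2(M,T)$ ($I$ regarded as a 1-form with values in the tangent bundle $T$). Locally there are flat coordinates $x_j$ in which $\nabla$ is ordinary differentiation and the matrix $(\omega_{jk})$ of the symplectic form is constant, and a function $\phi$ with $g_{jk}=\partial^2\phi/\partial x_j\partial x_k$, such that $I^j_k=\sum_a\omega^{ja}g_{ak}$, with $(\omega^{jk})$ the inverse of $(\omega_{jk})$. Here the coordinates are symplectic: $\omega_{j,n+j}=1=-\omega_{n+j,j}$ for $1\le j\le n$, other entries zero. Holomorphic prepotential: put $\xi_j=\partial\phi/\partial x_j$ for $1\le j\le 2n$ and, for $1\le j\le n$, $v_j=x_j+i\xi_{n+j}$ and $w_j=\xi_j+ix_{n+j}$. The image of $M$ in $\mathbf{C}^{2n}$ under $(v,w)$ is complex Lagrangian for $\sum dv_j\wedge dw_j$. A holomorphic prepotential is a holomorphic function $\mathcal F(w_1,\dots,w_n)$ such that $M$ is locally given by $v_j=\partial\mathcal F/\partial w_j$, $1\le j\le n$. Hyperkähler convention: a hyperkähler metric is determined by three symplectic forms $\omega_1,\omega_2,\omega_3$ such that, with $\varphi_i:T\to T^*$ the isomorphism determined by $\omega_i$, the endomorphisms $J_1=\varphi_3^{-1}\varphi_2$, $J_2=\varphi_1^{-1}\varphi_3$, $J_3=\varphi_2^{-1}\varphi_1$ satisfy the quaternionic identities. For the forms in the claim, $x_j+iy_j$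 ($1\le j\le 2n$) are holomorphic coordinates for $J_1$. Legendre transform method (Lindström–Roček): this constructs hyperkähler metrics of real dimension $4n$ with a triholomorphic action of $\mathbf{R}^n$ admitting an equivariant hyperkähler moment map to $\mathbf{R}^n\otimes\mathbf{R}^3$. One starts from a real function $F(\mathbf{x}_1,\dots,\mathbf{x}_n)$ of $\mathbf{x}_j\in\mathbf{R}^3$ such that, for each $(c_1,\dots,c_n)\in\mathbf{R}^n$, $F(c_1\mathbf{x},\dots,c_n\mathbf{x})$ satisfies the 3-dimensional Laplace equation in $\mathbf{x}$. Write $\mathbf{x}_j=(\xi_j,\operatorname{Re}z_j,\operatorname{Im}z_j)$. Complex coordinates for one complex structure (here $J_1$) are $z_1,\dots,z_n,u_1,\dots,u_n$, where $u_j+\bar u_j=\partial F/\partial\xi_j$. A Kähler potential for this complex structure, in the sign convention of that method, is the Legendre transform $K=F-\sum_{j=1}^n(u_j+\bar u_j)\xi_j$, expressed as a function of the $u_j,z_j$ and their conjugates. In the present case the $\mathbf{R}^n$ action is generated by $-\partial/\partial y_1,\dots,-\partial/\partial y_n$. The moment map coordinates are $\mathbf{x}_j=(\xi_j,-y_{n+j},x_{n+j})$, so $z_j=-y_{n+j}+ix_{n+j}=i(x_{n+j}+iy_{n+j})$. The function $F=\operatorname{Re}\mathcal F$ is regarded as a function of $\xi_j$ and $x_{n+j}$, $1\le j\le n$, through $w_j=\xi_j+ix_{n+j}$. *)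

theory Defs
  imports "HOL-Analysis.Analysis"
begin

section \<open>Smooth functions, partial derivatives, forms\<close>

text \<open>Used on open sets only.\<close>

primrec Ck_on :: "nat \<Rightarrow> 'a::euclidean_space set \<Rightarrow> ('a \<Rightarrow> 'b::real_normed_vector) \<Rightarrow> bool" where
  "Ck_on 0 S f \<longleftrightarrow> continuous_on S f"
| "Ck_on (Suc k) S f \<longleftrightarrow> (\<forall>x\<in>S. f differentiable (at x)) \<and>
     (\<forall>b\<in>Basis. Ck_on k S (\<lambda>x. frechet_derivative f (at x) b))"

definition smooth_on :: "'a::euclidean_space set \<Rightarrow> ('a \<Rightarrow> 'b::real_normed_vector) \<Rightarrow> bool" where
  "smooth_on S f \<longleftrightarrow> (\<forall>k. Ck_on k S f)"

text \<open>For a complex differentiable function on \<open>complex ^ 'n\<close> this is the complex partial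
  derivative, since the derivative is then complex linear.\<close>

definition partial_deriv ::
    "'n::finite \<Rightarrow> ('k::real_normed_field ^ 'n \<Rightarrow> 'b::real_normed_vector) \<Rightarrow> 'k ^ 'n \<Rightarrow> 'b" where
  "partial_deriv j f x = frechet_derivative f (at x) (axis j 1)"

definition hessian :: "(real ^ 'm \<Rightarrow> real) \<Rightarrow> real ^ 'm \<Rightarrow> real ^ 'm ^ 'm::finite" where
  "hessian \<phi> x = (\<chi> j k. partial_deriv j (partial_deriv k \<phi>) x)"

definition wedge :: "('a \<Rightarrow> 'c::comm_ring) \<Rightarrow> ('a \<Rightarrow> 'c) \<Rightarrow> 'a \<Rightarrow> 'a \<Rightarrow> 'c" where
  "wedge \<alpha> \<beta> X Y = \<alpha> X * \<beta> Y - \<alpha> Y * \<beta> X"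

text \<open>A field of bilinear forms: \<open>\<omega> p X Y\<close> with \<open>p\<close> the base point. By currying, \<open>\<omega> p\<close>, read as a
  map \<open>X \<mapsto> \<omega> p X\<close> into functionals, is the map from vectors to covectors determined by \<open>\<omega>\<close>.
  Closedness is the formula for the exterior derivative on constant vector fields.\<close>

type_synonym 'a form2 = "'a \<Rightarrow> 'a \<Rightarrow> 'a \<Rightarrow> real"

definition closed_form2 :: "'a::euclidean_space set \<Rightarrow> 'a form2 \<Rightarrow> bool" where
  "closed_form2 N \<omega> \<longleftrightarrow> (\<forall>p\<in>N. \<forall>X Y Z.
     frechet_derivative (\<lambda>q. \<omega> q Y Z) (at p) X
   - frechet_derivative (\<lambda>q. \<omega> q X Z) (at p) Y
   + frechet_derivative (\<lambda>q. \<omega> q X Y) (at p) Z = 0)"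

definition symplectic_form :: "'a::euclidean_space set \<Rightarrow> 'a form2 \<Rightarrow> bool" where
  "symplectic_form N \<omega> \<longleftrightarrow>
     (\<forall>p\<in>N. bilinear (\<omega> p) \<and> (\<forall>X. \<omega> p X X = 0) \<and> inj (\<omega> p)) \<and>
     (\<forall>X Y. smooth_on N (\<lambda>p. \<omega> p X Y)) \<and> closed_form2 N \<omega>"

definition complex_chart ::
    "'a::euclidean_space set \<Rightarrow> ('a \<Rightarrow> 'a \<Rightarrow> 'a) \<Rightarrow> ('a \<Rightarrow> complex ^ 'm::finite) \<Rightarrow> bool" where
  "complex_chart N J h \<longleftrightarrow> smooth_on N h \<and> inj_on h N \<and> open (h ` N) \<and>
     (\<forall>p\<in>N. bij (frechet_derivative h (at p)) \<and>
        (\<forall>X. frechet_derivative h (at p) (J p X) = \<i> *s frechet_derivative h (at p) X))"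


section \<open>Special Kaehler structures in flat coordinates\<close>

text \<open>The index type \<open>'n + 'n\<close> stands for \<open>1, \<dots>, 2n\<close>: \<open>Inl j\<close> is \<open>j\<close> and \<open>Inr j\<close> is \<open>n + j\<close>.\<close>

definition symp_matrix :: "real ^ ('n::finite + 'n) ^ ('n + 'n)" where
  "symp_matrix = (\<chi> a b. case (a, b) of
      (Inl j, Inr k) \<Rightarrow> if j = k then 1 else 0
    | (Inr j, Inl k) \<Rightarrow> if j = k then - 1 else 0
    | _ \<Rightarrow> 0)"

text \<open>A special Kaehler structure on an open set \<open>U\<close> of flat coordinates. The connection is ordinary
  differentiation, so it is flat and torsion free, and \<open>\<nabla>\<omega> = 0\<close> says that the matrix \<open>\<Omega>\<close> of the
  Kaehler form is constant. The relation \<open>I = \<Omega>\<^sup>-\<^sup>1 g\<close> between metric, complex structure and Kaehler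
  form means \<open>\<omega>(X, I Y) = g(X, Y)\<close>. The last clause is \<open>d\<^sub>\<nabla> I = 0\<close>.\<close>

definition special_kaehler_on ::
    "(real ^ ('n::finite + 'n)) set \<Rightarrow> real ^ ('n + 'n) ^ ('n + 'n) \<Rightarrow>
     (real ^ ('n + 'n) \<Rightarrow> real ^ ('n + 'n) ^ ('n + 'n)) \<Rightarrow>
     (real ^ ('n + 'n) \<Rightarrow> real ^ ('n + 'n) ^ ('n + 'n)) \<Rightarrow> bool" where
  "special_kaehler_on U \<Omega> g I \<longleftrightarrow>
     open U \<and> smooth_on U g \<and> smooth_on U I \<and>
     invertible \<Omega> \<and> transpose \<Omega> = - \<Omega> \<and>
     (\<forall>x\<in>U. I x ** I x = - mat 1) \<and>
     (\<forall>x\<in>U. \<exists>V h. x \<in> V \<and> V \<subseteq> U \<and> open V \<and>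
        complex_chart V (\<lambda>p X. I p *v X) (h :: real ^ ('n + 'n) \<Rightarrow> complex ^ 'n)) \<and>
     (\<forall>x\<in>U. transpose (g x) = g x \<and> (\<forall>X. X \<noteq> 0 \<longrightarrow> X \<bullet> (g x *v X) > 0)) \<and>
     (\<forall>x\<in>U. transpose (I x) ** g x ** I x = g x) \<and>
     (\<forall>x\<in>U. I x = matrix_inv \<Omega> ** g x) \<and>
     (\<forall>x\<in>U. \<forall>a b c. partial_deriv b (\<lambda>y. I y $ a $ c) x = partial_deriv c (\<lambda>y. I y $ a $ b) x)"

definition v_coord :: "(real ^ ('n::finite + 'n) \<Rightarrow> real) \<Rightarrow> real ^ ('n + 'n) \<Rightarrow> complex ^ 'n" where
  "v_coord \<phi> x = (\<chi> j. Complex (x $ Inl j) (partial_deriv (Inr j) \<phi> x))"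

definition w_coord :: "(real ^ ('n::finite + 'n) \<Rightarrow> real) \<Rightarrow> real ^ ('n + 'n) \<Rightarrow> complex ^ 'n" where
  "w_coord \<phi> x = (\<chi> j. Complex (partial_deriv (Inl j) \<phi> x) (x $ Inr j))"

definition holomorphic_cn :: "(complex ^ 'n::finite) set \<Rightarrow> (complex ^ 'n \<Rightarrow> complex) \<Rightarrow> bool" where
  "holomorphic_cn W f \<longleftrightarrow> open W \<and>
     (\<forall>w\<in>W. \<exists>D. (f has_derivative D) (at w) \<and> (\<forall>c h. D (c *s h) = c * D h))"

definition holomorphic_prepotential ::
    "(real ^ ('n::finite + 'n)) set \<Rightarrow> (real ^ ('n + 'n) \<Rightarrow> real) \<Rightarrow>
     (complex ^ 'n) set \<Rightarrow> (complex ^ 'n \<Rightarrow> complex) \<Rightarrow> bool" where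
  "holomorphic_prepotential U \<phi> W \<F> \<longleftrightarrow> holomorphic_cn W \<F> \<and>
     (\<forall>x\<in>U. w_coord \<phi> x \<in> W \<and> (\<forall>j. v_coord \<phi> x $ j = partial_deriv j \<F> (w_coord \<phi> x)))"


section \<open>Hyperkaehler structures\<close>

text \<open>\<open>\<phi>\<^sub>a\<^sup>-\<^sup>1 \<phi>\<^sub>b\<close> for the maps from vectors to covectors determined by two forms.\<close>

definition form_quotient :: "'a form2 \<Rightarrow> 'a form2 \<Rightarrow> 'a \<Rightarrow> 'a \<Rightarrow> 'a" where
  "form_quotient a b p = inv (a p) \<circ> b p"

text \<open>The metric is \<open>g(X, Y) = \<omega>\<^sub>1(X, J\<^sub>1 Y)\<close>.\<close>

definition hyperkaehler ::
    "'a::euclidean_space set \<Rightarrow> 'a form2 \<Rightarrow> 'a form2 \<Rightarrow> 'a form2 \<Rightarrow> bool" where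
  "hyperkaehler N \<omega>1 \<omega>2 \<omega>3 \<longleftrightarrow>
     symplectic_form N \<omega>1 \<and> symplectic_form N \<omega>2 \<and> symplectic_form N \<omega>3 \<and>
     (\<forall>p\<in>N. let J1 = form_quotient \<omega>3 \<omega>2 p;
                J2 = form_quotient \<omega>1 \<omega>3 p;
                J3 = form_quotient \<omega>2 \<omega>1 p
       in J1 \<circ> J1 = uminus \<and> J2 \<circ> J2 = uminus \<and> J3 \<circ> J3 = uminus \<and> J1 \<circ> J2 = J3 \<and>
          (\<forall>X Y. \<omega>1 p X (J1 Y) = \<omega>1 p Y (J1 X)) \<and>
          (\<forall>X. X \<noteq> 0 \<longrightarrow> \<omega>1 p X (J1 X) > 0))"


section \<open>The Legendre transform method\<close>

text \<open>Points of \<open>(real ^ 3) ^ 'n\<close> are \<open>(\<^bold>x\<^sub>1, \<dots>, \<^bold>x\<^sub>n)\<close> with \<open>\<^bold>x\<^sub>j = (\<xi>\<^sub>j, Re z\<^sub>j, Im z\<^sub>j)\<close>.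

  The Laplace equation is required along all maps \<open>\<^bold>x \<mapsto> (a\<^sub>j + c\<^sub>j \<^bold>x)\<^sub>j\<close>. The case \<open>a = 0\<close> is the
  condition on \<open>F (c\<^sub>1 \<^bold>x, \<dots>, c\<^sub>n \<^bold>x)\<close>. It alone would be vacuous on domains \<open>D\<close> containing no
  point of that form; the condition for all \<open>a\<close> is its translation invariant, hence local, form.\<close>

definition laplace3_on :: "(real ^ 3) set \<Rightarrow> (real ^ 3 \<Rightarrow> real) \<Rightarrow> bool" where
  "laplace3_on S G \<longleftrightarrow> Ck_on 2 S G \<and>
     (\<forall>x\<in>S. (\<Sum>i\<in>UNIV. partial_deriv i (partial_deriv i G) x) = 0)"

definition legendre_input :: "((real ^ 3) ^ 'n::finite) set \<Rightarrow> ((real ^ 3) ^ 'n \<Rightarrow> real) \<Rightarrow> bool" where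
  "legendre_input D F \<longleftrightarrow> open D \<and> (\<forall>\<x>\<in>D. F differentiable (at \<x>)) \<and>
     (\<forall>(a :: (real ^ 3) ^ 'n) (c :: real ^ 'n).
        laplace3_on {x. (\<chi> j. a $ j + (c $ j) *\<^sub>R x) \<in> D} (\<lambda>x. F (\<chi> j. a $ j + (c $ j) *\<^sub>R x)))"

definition triholomorphic_action ::
    "'a::euclidean_space set \<Rightarrow> 'a form2 \<Rightarrow> 'a form2 \<Rightarrow> 'a form2 \<Rightarrow> (real ^ 'n::finite \<Rightarrow> 'a \<Rightarrow> 'a) \<Rightarrow> bool"
    where
  "triholomorphic_action N \<omega>1 \<omega>2 \<omega>3 \<rho> \<longleftrightarrow>
     smooth_on (UNIV \<times> N) (\<lambda>(t, p). \<rho> t p) \<and>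
     (\<forall>p\<in>N. \<rho> 0 p = p \<and> (\<forall>t. \<rho> t p \<in> N) \<and> (\<forall>s t. \<rho> (s + t) p = \<rho> s (\<rho> t p))) \<and>
     (\<forall>p\<in>N. \<forall>t. \<forall>J \<in> {form_quotient \<omega>3 \<omega>2, form_quotient \<omega>1 \<omega>3, form_quotient \<omega>2 \<omega>1}.
        frechet_derivative (\<rho> t) (at p) \<circ> J p = J (\<rho> t p) \<circ> frechet_derivative (\<rho> t) (at p))"

definition generated_by ::
    "'a::euclidean_space set \<Rightarrow> (real ^ 'n::finite \<Rightarrow> 'a \<Rightarrow> 'a) \<Rightarrow> ('n \<Rightarrow> 'a \<Rightarrow> 'a) \<Rightarrow> bool" where
  "generated_by N \<rho> X \<longleftrightarrow>
     (\<forall>p\<in>N. \<forall>j. ((\<lambda>s. \<rho> (s *\<^sub>R axis j 1) p) has_vector_derivative X j p) (at 0))"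

text \<open>The group is abelian, so its coadjoint action is trivial and equivariance is invariance.\<close>

definition hyperkaehler_moment_map ::
    "'a::euclidean_space set \<Rightarrow> 'a form2 \<Rightarrow> 'a form2 \<Rightarrow> 'a form2 \<Rightarrow> (real ^ 'n::finite \<Rightarrow> 'a \<Rightarrow> 'a) \<Rightarrow>
     ('n \<Rightarrow> 'a \<Rightarrow> 'a) \<Rightarrow> ('a \<Rightarrow> (real ^ 3) ^ 'n) \<Rightarrow> bool" where
  "hyperkaehler_moment_map N \<omega>1 \<omega>2 \<omega>3 \<rho> X \<mu> \<longleftrightarrow> smooth_on N \<mu> \<and>
     (\<forall>p\<in>N. \<forall>j Y.
        \<omega>1 p (X j p) Y = frechet_derivative (\<lambda>q. \<mu> q $ j $ 1) (at p) Y \<and>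
        \<omega>2 p (X j p) Y = frechet_derivative (\<lambda>q. \<mu> q $ j $ 2) (at p) Y \<and>
        \<omega>3 p (X j p) Y = frechet_derivative (\<lambda>q. \<mu> q $ j $ 3) (at p) Y) \<and>
     (\<forall>p\<in>N. \<forall>t. \<mu> (\<rho> t p) = \<mu> p)"

definition wirtinger :: "'m::finite \<Rightarrow> (complex ^ 'm \<Rightarrow> complex) \<Rightarrow> complex ^ 'm \<Rightarrow> complex" where
  "wirtinger a f \<zeta> = (frechet_derivative f (at \<zeta>) (axis a 1)
                      - \<i> * frechet_derivative f (at \<zeta>) (axis a \<i>)) / 2"

definition wirtinger_bar :: "'m::finite \<Rightarrow> (complex ^ 'm \<Rightarrow> complex) \<Rightarrow> complex ^ 'm \<Rightarrow> complex" where
  "wirtinger_bar a f \<zeta> = (frechet_derivative f (at \<zeta>) (axis a 1)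
                          + \<i> * frechet_derivative f (at \<zeta>) (axis a \<i>)) / 2"

text \<open>The 2-form del del-bar of \<open>K\<close>, with \<open>K\<close> given as a function of the complex coordinates \<open>h\<close>.\<close>

definition ddbar ::
    "('a::euclidean_space \<Rightarrow> complex ^ 'm::finite) \<Rightarrow> (complex ^ 'm \<Rightarrow> real) \<Rightarrow> 'a \<Rightarrow> 'a \<Rightarrow> 'a \<Rightarrow> complex"
    where
  "ddbar h K p X Y =
     (\<Sum>a\<in>UNIV. \<Sum>b\<in>UNIV.
        wirtinger a (wirtinger_bar b (\<lambda>\<zeta>. complex_of_real (K \<zeta>))) (h p) *
        wedge (\<lambda>V. frechet_derivative h (at p) V $ a)
              (\<lambda>V. cnj (frechet_derivative h (at p) V $ b)) X Y)"

definition z_of :: "(real ^ 3) ^ 'n \<Rightarrow> complex ^ 'n::finite" where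
  "z_of \<x> = (\<chi> j. Complex (\<x> $ j $ 2) (\<x> $ j $ 3))"

definition dF_dxi :: "((real ^ 3) ^ 'n::finite \<Rightarrow> real) \<Rightarrow> 'n \<Rightarrow> (real ^ 3) ^ 'n \<Rightarrow> real" where
  "dF_dxi F j \<x> = frechet_derivative F (at \<x>) (axis j (axis 1 1))"

definition zu_coord ::
    "('a \<Rightarrow> (real ^ 3) ^ 'n) \<Rightarrow> ('a \<Rightarrow> complex ^ 'n) \<Rightarrow> 'a \<Rightarrow> complex ^ ('n::finite + 'n)" where
  "zu_coord \<mu> u p = (\<chi> a. case a of Inl j \<Rightarrow> z_of (\<mu> p) $ j | Inr j \<Rightarrow> u p $ j)"

definition legendre_transform ::
    "((real ^ 3) ^ 'n::finite \<Rightarrow> real) \<Rightarrow> ('a \<Rightarrow> (real ^ 3) ^ 'n) \<Rightarrow> ('a \<Rightarrow> complex ^ 'n) \<Rightarrow> 'a \<Rightarrow> real" where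
  "legendre_transform F \<mu> u p = F (\<mu> p) - (\<Sum>j\<in>UNIV. Re (u p $ j + cnj (u p $ j)) * \<mu> p $ j $ 1)"

text \<open>The hyperkaehler structure on \<open>N\<close>, with the action generated by the fields \<open>X\<close> and with moment
  map \<open>\<mu>\<close>, arises from \<open>F\<close> by the Legendre transform method.

  Sign and scale of the potential: \<open>\<partial>K/\<partial>u\<^sub>j = -\<xi>\<^sub>j\<close> for the Legendre transform \<open>K\<close>. The last clause
  and the moment map equations for \<open>\<omega>\<^sub>2 + i \<omega>\<^sub>3\<close> give \<open>du\<^sub>k(X\<^sub>j) = -i \<delta>\<^sub>j\<^sub>k / 2\<close>, and then \<open>\<xi>\<^sub>j\<close> is a moment
  map for \<open>X\<^sub>j\<close> and a multiple \<open>c\<close> of the 2-form del del-bar of \<open>K\<close> exactly when \<open>c = -2i\<close>.\<close>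

definition legendre_construction ::
    "'a::euclidean_space set \<Rightarrow> 'a form2 \<Rightarrow> 'a form2 \<Rightarrow> 'a form2 \<Rightarrow>
     ('n::finite \<Rightarrow> 'a \<Rightarrow> 'a) \<Rightarrow> ('a \<Rightarrow> (real ^ 3) ^ 'n) \<Rightarrow>
     ((real ^ 3) ^ 'n) set \<Rightarrow> ((real ^ 3) ^ 'n \<Rightarrow> real) \<Rightarrow> bool" where
  "legendre_construction N \<omega>1 \<omega>2 \<omega>3 X \<mu> D F \<longleftrightarrow>
     open N \<and> DIM('a) = 4 * CARD('n) \<and> hyperkaehler N \<omega>1 \<omega>2 \<omega>3 \<and>
     legendre_input D F \<and> \<mu> ` N \<subseteq> D \<and>
     (\<exists>\<rho>. triholomorphic_action N \<omega>1 \<omega>2 \<omega>3 \<rho> \<and> generated_by N \<rho> X \<and>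
          hyperkaehler_moment_map N \<omega>1 \<omega>2 \<omega>3 \<rho> X \<mu>) \<and>
     (\<exists>u. (\<forall>p\<in>N. \<forall>j. u p $ j + cnj (u p $ j) = complex_of_real (dF_dxi F j (\<mu> p))) \<and>
          complex_chart N (form_quotient \<omega>3 \<omega>2) (zu_coord \<mu> u) \<and>
          (\<exists>K. smooth_on (zu_coord \<mu> u ` N) K \<and>
               (\<forall>p\<in>N. K (zu_coord \<mu> u p) = legendre_transform F \<mu> u p) \<and>
               (\<forall>p\<in>N. \<forall>Y Z. complex_of_real (\<omega>1 p Y Z) = - 2 * \<i> * ddbar (zu_coord \<mu> u) K p Y Z)) \<and>
          (\<forall>p\<in>N. \<forall>Y Z. Complex (\<omega>2 p Y Z) (\<omega>3 p Y Z) =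
             2 * \<i> * (\<Sum>j\<in>UNIV. wedge (\<lambda>V. frechet_derivative u (at p) V $ j)
                                       (\<lambda>V. frechet_derivative (\<lambda>q. z_of (\<mu> q)) (at p) V $ j) Y Z)))"


section \<open>The forms on \<open>M \<times> \<real>\<^sup>2\<^sup>n\<close>\<close>

type_synonym 'n phase = "(real ^ ('n + 'n)) \<times> (real ^ ('n + 'n))"

definition dx :: "('n::finite + 'n) \<Rightarrow> 'n phase \<Rightarrow> real" where
  "dx a X = fst X $ a"

definition dy :: "('n::finite + 'n) \<Rightarrow> 'n phase \<Rightarrow> real" where
  "dy a X = snd X $ a"

definition dxy :: "('n::finite + 'n) \<Rightarrow> 'n phase \<Rightarrow> complex" where
  "dxy a X = complex_of_real (dx a X) + \<i> * complex_of_real (dy a X)"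

definition omega1 :: "(real ^ ('n::finite + 'n) \<Rightarrow> real) \<Rightarrow> 'n phase form2" where
  "omega1 \<phi> p X Y = (\<Sum>j\<in>UNIV. \<Sum>k\<in>UNIV. hessian \<phi> (fst p) $ j $ k * wedge (dx j) (dy k) X Y)"

definition omega23 :: "'n::finite phase \<Rightarrow> 'n phase \<Rightarrow> 'n phase \<Rightarrow> complex" where
  "omega23 p X Y = - (1 / 2) * (\<Sum>j\<in>UNIV. \<Sum>k\<in>UNIV.
     complex_of_real (symp_matrix $ j $ k) * wedge (dxy j) (dxy k) X Y)"

definition omega2 :: "'n::finite phase form2" where
  "omega2 p X Y = Re (omega23 p X Y)"

definition omega3 :: "'n::finite phase form2" where
  "omega3 p X Y = Im (omega23 p X Y)"

text \<open>The vector field \<open>-\<partial>/\<partial>y\<^sub>j\<close>, \<open>1 \<le> j \<le> n\<close>.\<close>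

definition action_field :: "'n::finite \<Rightarrow> 'n phase \<Rightarrow> 'n phase" where
  "action_field j p = (0, - axis (Inl j) 1)"

definition moment_coord ::
    "(real ^ ('n::finite + 'n) \<Rightarrow> real) \<Rightarrow> 'n phase \<Rightarrow> (real ^ 3) ^ 'n" where
  "moment_coord \<phi> p =
     (\<chi> j. vector [partial_deriv (Inl j) \<phi> (fst p), - (snd p $ Inr j), fst p $ Inr j])"

text \<open>\<open>w\<^sub>j = \<xi>\<^sub>j + i x\<^sub>n\<^sub>+\<^sub>j\<close> in terms of \<open>\<^bold>x\<^sub>j\<close>, where \<open>x\<^sub>n\<^sub>+\<^sub>j = Im z\<^sub>j\<close>.\<close>

definition w_of :: "(real ^ 3) ^ 'n \<Rightarrow> complex ^ 'n::finite" where
  "w_of \<x> = (\<chi> j. Complex (\<x> $ j $ 1) (\<x> $ j $ 3))"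

end

theory Submission
  imports Defs "HOL-Complex_Analysis.Cauchy_Integral_Formula"
begin

text \<open>Everything can be computed in the flat coordinates \<open>(x, y)\<close>.

The function \<open>F = Re \<F>\<close> satisfies the Laplace equations because along \<open>\<^bold>x \<mapsto> (a\<^sub>j + c\<^sub>j \<^bold>x)\<^sub>j\<close> it is the
real part of \<open>\<F>\<close> restricted to the complex line \<open>t \<mapsto> b + t d\<close>, that is, a harmonic function of the
first and third coordinate of \<open>\<^bold>x\<close>, constant in the second
(\<open>laplace3_on_Re_holomorphic\<close>).

The hyperkaehler structure is explicit. Write \<open>\<Omega>\<close> for the matrix of the symplectic form and
\<open>g\<close> for the Hessian of \<open>\<phi>\<close>, so that \<open>\<Omega> I = g\<close>. Then on tangent vectors \<open>(X, Y)\<close> the quotients of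
the three forms are \<open>J1 (X, Y) = (- Y, X)\<close>, \<open>J2 (X, Y) = (- I X, I Y)\<close> and
\<open>J3 (X, Y) = (- I Y, - I X)\<close>; the quaternionic identities reduce to \<open>I\<^sup>2 = - 1\<close>, and the metric is
\<open>g\<close> on both factors. Of the three forms only \<open>\<omega>\<^sub>1\<close> has non-constant coefficients, and its closedness
is the total symmetry of the derivative of \<open>g\<close>, which is what \<open>d\<^sub>\<nabla> I = 0\<close> says.

The translations in \<open>y\<^sub>1, \<dots>, y\<^sub>n\<close> preserve all of this, and the moment map equations can be
read off: \<open>d\<xi>\<^sub>j\<close> is the \<open>j\<close>-th row of \<open>g\<close>, the other two coordinates are linear.

Since \<open>\<partial>F/\<partial>\<xi>\<^sub>j = Re v\<^sub>j = x\<^sub>j\<close>, one may take \<open>u\<^sub>j = (x\<^sub>j + i y\<^sub>j) / 2\<close>, which makes the complex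
coordinates \<open>(z, u)\<close> real linear in \<open>(x, y)\<close>. The heart of the matter is that the Legendre
transform \<open>K = F - \<Sum> x\<^sub>j \<xi>\<^sub>j\<close> is \<open>- \<phi>\<close> up to a locally constant function: from
\<open>d\<F> = \<Sum> v\<^sub>j dw\<^sub>j\<close> one gets \<open>dF = \<Sum> (x\<^sub>j d\<xi>\<^sub>j - \<xi>\<^sub>n\<^sub>+\<^sub>j dx\<^sub>n\<^sub>+\<^sub>j)\<close>, and subtracting
\<open>\<Sum> d(x\<^sub>j \<xi>\<^sub>j)\<close> leaves \<open>- \<Sum> \<xi>\<^sub>a dx\<^sub>a = - d\<phi>\<close> (\<open>has_derivative_base_potential\<close>). A function of \<open>x\<close> alone with
this differential has mixed complex second derivatives proportional to \<open>g\<close>, so the form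
del del-bar of \<open>K\<close> is \<open>(i/2) \<omega>\<^sub>1\<close> (\<open>ddbar_potential\<close>).\<close>

section \<open>Smooth functions\<close>

lemma frechet_derivative_eqI:
  "(f has_derivative f') (at x) \<Longrightarrow> frechet_derivative f (at x) = f'"
  by (simp add: frechet_derivative_at[symmetric])

text \<open>The derivatives in \<open>Ck_on\<close> are taken in the whole space rather than within \<open>S\<close>; they depend on the values
on \<open>S\<close> alone because \<open>S\<close> is open.\<close>

lemma Ck_on_cong:
  assumes "open S" "\<And>x. x \<in> S \<Longrightarrow> f x = g x" "Ck_on k S f"
  shows "Ck_on k S g"
  using assms(2,3)
proof (induction k arbitrary: f g)
  case 0
  then show ?case using continuous_on_cong by force
next
  case (Suc k)
  have d: "(g has_derivative frechet_derivative f (at x)) (at x)" if "x \<in> S" for x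
    using Suc.prems that assms(1)
    by (auto intro: has_derivative_transform_within_open simp: frechet_derivative_works)
  have "Ck_on k S (\<lambda>x. frechet_derivative g (at x) b)" if "b \<in> Basis" for b
    by (rule Suc.IH[of "\<lambda>x. frechet_derivative f (at x) b"])
      (use Suc.prems that in \<open>simp_all add: frechet_derivative_eqI[OF d]\<close>)
  then show ?case using d by (auto simp: differentiable_def)
qed

lemma Ck_on_SucI:
  assumes "open S" "\<And>x. x \<in> S \<Longrightarrow> (f has_derivative f' x) (at x)"
    and "\<And>b. b \<in> Basis \<Longrightarrow> Ck_on k S (\<lambda>x. f' x b)"
  shows "Ck_on (Suc k) S f"
proof -
  have "Ck_on k S (\<lambda>x. frechet_derivative f (at x) b)" if "b \<in> Basis" for b
    by (rule Ck_on_cong[OF assms(1) _ assms(3)[OF that]])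
      (simp add: frechet_derivative_eqI[OF assms(2)])
  then show ?thesis using assms(2) by (auto simp: differentiable_def)
qed

lemma Ck_on_SucD:
  assumes "Ck_on (Suc k) S f" "x \<in> S"
  shows "(f has_derivative frechet_derivative f (at x)) (at x)"
  using assms by (simp add: frechet_derivative_works)

lemma Ck_on_const: "open S \<Longrightarrow> Ck_on k S (\<lambda>x. c)"
proof (induction k arbitrary: c)
  case (Suc k)
  then show ?case by (auto intro!: Ck_on_SucI[where f' = "\<lambda>x h. 0"])
qed simp

lemma Ck_on_add:
  "open S \<Longrightarrow> Ck_on k S f \<Longrightarrow> Ck_on k S g \<Longrightarrow> Ck_on k S (\<lambda>x. f x + g x)"
proof (induction k arbitrary: f g)
  case 0
  then show ?case by (auto intro: continuous_intros)
next
  case (Suc k)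
  show ?case
    by (rule Ck_on_SucI[OF Suc.prems(1) has_derivative_add])
      (use Suc in \<open>auto simp: frechet_derivative_works\<close>)
qed

lemma Ck_on_sum:
  assumes "open S" "\<And>i. i \<in> A \<Longrightarrow> Ck_on k S (f i)"
  shows "Ck_on k S (\<lambda>x. \<Sum>i\<in>A. f i x)"
  using assms(2)
  by (induction A rule: infinite_finite_induct) (simp_all add: assms(1) Ck_on_const Ck_on_add)

lemma Ck_on_linear_image:
  assumes "bounded_linear T"
  shows "open S \<Longrightarrow> Ck_on k S f \<Longrightarrow> Ck_on k S (\<lambda>x. T (f x))"
proof (induction k arbitrary: f)
  case 0
  then show ?case using bounded_linear.continuous_on[OF assms] by simp
next
  case (Suc k)
  show ?case
    by (rule Ck_on_SucI[OF Suc.prems(1) bounded_linear.has_derivative[OF assms]])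
      (use Suc in \<open>auto simp: frechet_derivative_works\<close>)
qed

text \<open>The derivative of \<open>f \<circ> L\<close> in a basis direction \<open>b\<close> is the derivative of \<open>f\<close> in the direction \<open>L b\<close>,
which is no basis vector; expanding \<open>L b\<close> in the basis makes the induction hypothesis applicable
without any product rule.\<close>

lemma Ck_on_compose_linear:
  fixes L :: "'a::euclidean_space \<Rightarrow> 'b::euclidean_space"
  assumes "bounded_linear L" "open T" "open S" "L ` T \<subseteq> S"
  shows "Ck_on k S f \<Longrightarrow> Ck_on k T (\<lambda>x. f (L x))"
proof (induction k arbitrary: f)
  case 0
  then show ?case
    using continuous_on_compose2[OF _ bounded_linear.continuous_on[OF assms(1) continuous_on_id] assms(4)]
    by simp
next
  case (Suc k)
  let ?D = "\<lambda>x. frechet_derivative f (at (L x))"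
  have f: "(f has_derivative ?D x) (at (L x))" if "x \<in> T" for x
    using Ck_on_SucD[OF Suc.prems] assms(4) that by auto
  have lin: "?D x (L b) = (\<Sum>c\<in>Basis. (L b \<bullet> c) *\<^sub>R ?D x c)" if "x \<in> T" for x b
  proof -
    interpret bounded_linear "?D x" by (rule has_derivative_bounded_linear[OF f[OF that]])
    have "?D x (L b) = ?D x (\<Sum>c\<in>Basis. (L b \<bullet> c) *\<^sub>R c)"
      by (simp only: euclidean_representation)
    then show ?thesis by (simp only: sum scaleR)
  qed
  show ?case
  proof (rule Ck_on_SucI[OF assms(2)])
    show "((\<lambda>x. f (L x)) has_derivative (\<lambda>h. ?D x (L h))) (at x)" if "x \<in> T" for x
      using has_derivative_compose[OF bounded_linear_imp_has_derivative[OF assms(1)] f[OF that]] .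
    have "Ck_on k T (\<lambda>x. ?D x c)" if "c \<in> Basis" for c
      by (rule Suc.IH) (use Suc.prems that in simp)
    then have "Ck_on k T (\<lambda>x. \<Sum>c\<in>Basis. (L b \<bullet> c) *\<^sub>R ?D x c)" for b
      by (intro Ck_on_sum assms(2) Ck_on_linear_image[OF bounded_linear_scaleR_right])
    then show "Ck_on k T (\<lambda>x. ?D x (L b))" for b
      by (rule Ck_on_cong[OF assms(2), rotated]) (rule lin[symmetric])
  qed
qed

lemma smooth_on_const: "open S \<Longrightarrow> smooth_on S (\<lambda>x. c)"
  and smooth_on_sum: "open S \<Longrightarrow> (\<And>i. i \<in> A \<Longrightarrow> smooth_on S (h i)) \<Longrightarrow> smooth_on S (\<lambda>x. \<Sum>i\<in>A. h i x)"
  and smooth_on_linear_image: "bounded_linear T \<Longrightarrow> open S \<Longrightarrow> smooth_on S f \<Longrightarrow> smooth_on S (\<lambda>x. T (f x))"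
  by (simp_all add: smooth_on_def Ck_on_const Ck_on_sum Ck_on_linear_image)

lemma smooth_on_cong:
  "open S \<Longrightarrow> (\<And>x. x \<in> S \<Longrightarrow> f x = g x) \<Longrightarrow> smooth_on S f \<Longrightarrow> smooth_on S g"
  unfolding smooth_on_def using Ck_on_cong[of S f g] by simp

lemma smooth_on_compose_linear:
  fixes L :: "'a::euclidean_space \<Rightarrow> 'b::euclidean_space"
  assumes "bounded_linear L" "open T" "open S" "L ` T \<subseteq> S" "smooth_on S f"
  shows "smooth_on T (\<lambda>x. f (L x))"
  using assms(5) Ck_on_compose_linear[OF assms(1-4)] unfolding smooth_on_def by blast

text \<open>This yields smoothness of the Kaehler potential from that of \<open>\<phi>\<close>, although \<open>\<F>\<close>, of which only complex differentiability is known, enters its definition.\<close>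

lemma smooth_on_derivative:
  assumes "open S" "\<And>x. x \<in> S \<Longrightarrow> (f has_derivative f' x) (at x)"
    and "\<And>b. b \<in> Basis \<Longrightarrow> smooth_on S (\<lambda>x. f' x b)"
  shows "smooth_on S f"
  unfolding smooth_on_def
proof
  fix k
  have "\<forall>x\<in>S. continuous (at x) f" using assms(2) has_derivative_continuous by blast
  then have "Ck_on 0 S f" by (simp add: continuous_at_imp_continuous_on)
  moreover have "Ck_on (Suc k) S f" for k
    by (rule Ck_on_SucI[OF assms(1,2)]) (use assms(3) in \<open>simp_all add: smooth_on_def\<close>)
  ultimately show "Ck_on k S f" by (metis not0_implies_Suc)
qed

lemma smooth_on_bounded_linear:
  assumes "bounded_linear L" "open S"
  shows "smooth_on S L"
  by (rule smooth_on_derivative[OF assms(2) bounded_linear_imp_has_derivative[OF assms(1)]])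
    (rule smooth_on_const[OF assms(2)])

lemma smooth_on_componentwise:
  fixes f :: "'a::euclidean_space \<Rightarrow> 'b::euclidean_space"
  assumes "open S" "\<And>b. b \<in> Basis \<Longrightarrow> smooth_on S (\<lambda>x. f x \<bullet> b)"
  shows "smooth_on S f"
proof -
  have "smooth_on S (\<lambda>x. \<Sum>b\<in>Basis. (f x \<bullet> b) *\<^sub>R b)"
    by (intro smooth_on_sum assms(1) smooth_on_linear_image[OF bounded_linear_scaleR_left] assms(2))
  then show ?thesis by (simp only: euclidean_representation)
qed

lemma smooth_on_has_derivative:
  assumes "smooth_on S f" "x \<in> S"
  shows "(f has_derivative frechet_derivative f (at x)) (at x)"
  using assms Ck_on_SucD[of 0] unfolding smooth_on_def by blast

lemma smooth_on_partial_deriv: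
  fixes f :: "real ^ 'm \<Rightarrow> 'b::real_normed_vector"
  assumes "smooth_on S f"
  shows "smooth_on S (partial_deriv j f)"
proof -
  have "axis j 1 \<in> (Basis :: (real ^ 'm) set)" by simp
  then have "Ck_on k S (\<lambda>x. frechet_derivative f (at x) (axis j 1))" for k
    using assms[unfolded smooth_on_def, rule_format, of "Suc k"] by simp
  then show ?thesis by (simp add: smooth_on_def partial_deriv_def[abs_def])
qed

lemma linear_vec_expansion:
  fixes D :: "real ^ 'm \<Rightarrow> 'b::real_vector"
  assumes "linear D"
  shows "D V = (\<Sum>k\<in>UNIV. V $ k *\<^sub>R D (axis k 1))"
proof -
  have "V = (\<Sum>k\<in>UNIV. V $ k *\<^sub>R axis k 1)"
    using basis_expansion[of V] by (simp add: scalar_mult_eq_scaleR)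
  then have "D V = D (\<Sum>k\<in>UNIV. V $ k *\<^sub>R axis k 1)" by simp
  also have "\<dots> = (\<Sum>k\<in>UNIV. V $ k *\<^sub>R D (axis k 1))"
    by (simp add: linear_sum[OF assms] linear_scale[OF assms])
  finally show ?thesis .
qed

lemma frechet_derivative_eq_partial_sum:
  fixes f :: "real ^ 'm \<Rightarrow> 'b::real_normed_vector"
  assumes "f differentiable (at x)"
  shows "frechet_derivative f (at x) V = (\<Sum>k\<in>UNIV. V $ k *\<^sub>R partial_deriv k f x)"
  unfolding partial_deriv_def by (rule linear_vec_expansion[OF linear_frechet_derivative[OF assms]])

section \<open>The Laplace equation\<close>

lemma bounded_linear_Complex:
  assumes "bounded_linear f" "bounded_linear g"
  shows "bounded_linear (\<lambda>x. Complex (f x) (g x))"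
proof -
  have "bounded_linear (\<lambda>x. complex_of_real (f x) + \<i> * complex_of_real (g x))"
    by (intro bounded_linear_add bounded_linear_const_mult
        bounded_linear_compose[OF bounded_linear_of_real] assms)
  then show ?thesis by (simp add: Complex_eq)
qed

lemma bounded_linear_vec_lambda:
  fixes f :: "'n::finite \<Rightarrow> 'a::real_normed_vector \<Rightarrow> 'b::euclidean_space"
  assumes "\<And>i. bounded_linear (f i)"
  shows "bounded_linear (\<lambda>x. \<chi> i. f i x)"
proof (rule iffD2[OF bounded_linear_componentwise_iff], rule ballI)
  fix b :: "'b ^ 'n" assume "b \<in> Basis"
  then obtain i c where "b = axis i c" by (auto simp: Basis_vec_def)
  then show "bounded_linear (\<lambda>x. (\<chi> i. f i x) \<bullet> b)"
    using bounded_linear_compose[OF bounded_linear_inner_left assms, of i c] by (simp add: inner_axis)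
qed

text \<open>The coordinate of the complex line in which \<open>w = \<xi> + i Im z\<close> varies when
\<open>\<^bold>x = (\<xi>, Re z, Im z)\<close> runs through 3-space.\<close>

definition line_coord :: "real ^ 3 \<Rightarrow> complex" where
  "line_coord x = Complex (x $ 1) (x $ 3)"

lemma bounded_linear_line_coord: "bounded_linear line_coord"
  unfolding line_coord_def[abs_def]
  by (rule bounded_linear_Complex[OF bounded_linear_vec_nth bounded_linear_vec_nth])

lemma has_derivative_Re_holomorphic:
  assumes "e holomorphic_on S" "open S" "line_coord x \<in> S"
  shows "((\<lambda>x. Re (c * e (line_coord x))) has_derivative
          (\<lambda>V. Re (c * line_coord V * deriv e (line_coord x)))) (at x)"
proof -
  have "(e has_derivative (\<lambda>h. deriv e (line_coord x) * h)) (at (line_coord x))"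
    using holomorphic_derivI[OF assms] by (simp add: has_field_derivative_def)
  from has_derivative_compose[OF bounded_linear_imp_has_derivative[OF bounded_linear_line_coord] this]
  have "((\<lambda>x. e (line_coord x)) has_derivative (\<lambda>V. deriv e (line_coord x) * line_coord V)) (at x)" .
  from bounded_linear.has_derivative[OF bounded_linear_Re has_derivative_mult_right[OF this, of c]]
  show ?thesis by (simp add: mult_ac)
qed

lemma open_line_coord_vimage: "open S \<Longrightarrow> open {x. line_coord x \<in> S}"
  using open_vimage[OF _ bounded_linear.continuous_on[OF bounded_linear_line_coord continuous_on_id]]
  by (simp add: vimage_def)

text \<open>The constant factor \<open>c\<close> keeps the family of functions closed under directional derivatives: the
direction \<open>b\<close> multiplies \<open>c\<close> by \<open>line_coord b\<close> and replaces \<open>e\<close> by \<open>e'\<close>.\<close>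

lemma Ck_on_Re_holomorphic:
  assumes "open S"
  shows "e holomorphic_on S \<Longrightarrow> Ck_on k {x. line_coord x \<in> S} (\<lambda>x. Re (c * e (line_coord x)))"
proof (induction k arbitrary: e c)
  case 0
  have "isCont (\<lambda>x. Re (c * e (line_coord x))) x" if "line_coord x \<in> S" for x
    using has_derivative_continuous[OF has_derivative_Re_holomorphic[OF 0 assms that]] .
  then show ?case by (simp add: continuous_at_imp_continuous_on)
next
  case (Suc k)
  show ?case
  proof (rule Ck_on_SucI[OF open_line_coord_vimage[OF assms]])
    show "((\<lambda>x. Re (c * e (line_coord x))) has_derivative
          (\<lambda>V. Re (c * line_coord V * deriv e (line_coord x)))) (at x)"
      if "x \<in> {x. line_coord x \<in> S}" for x
      using has_derivative_Re_holomorphic[OF Suc.prems assms] that by simp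
    show "Ck_on k {x. line_coord x \<in> S} (\<lambda>x. Re (c * line_coord b * deriv e (line_coord x)))" for b
      by (rule Suc.IH[OF holomorphic_deriv[OF Suc.prems assms]])
  qed
qed

lemma partial_deriv_Re_holomorphic:
  assumes "e holomorphic_on S" "open S" "line_coord x \<in> S"
  shows "partial_deriv i (\<lambda>x. Re (c * e (line_coord x))) x =
    Re (c * line_coord (axis i 1) * deriv e (line_coord x))"
  unfolding partial_deriv_def frechet_derivative_eqI[OF has_derivative_Re_holomorphic[OF assms]]
  by (rule refl)

text \<open>The three coordinate directions go to \<open>1\<close>, \<open>0\<close> and \<open>\<i>\<close>, so the second partial derivatives are the real
parts of \<open>e''\<close>, \<open>0\<close> and \<open>\<i>\<^sup>2 e'' = - e''\<close>.\<close>

lemma laplace3_on_Re_holomorphic: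
  assumes "e holomorphic_on S" "open S"
  shows "laplace3_on {x. line_coord x \<in> S} (\<lambda>x. Re (e (line_coord x)))"
  unfolding laplace3_on_def
proof (intro conjI ballI)
  show "Ck_on 2 {x. line_coord x \<in> S} (\<lambda>x. Re (e (line_coord x)))"
    using Ck_on_Re_holomorphic[OF assms(2,1), where c = 1] by simp
next
  fix x assume x: "x \<in> {x. line_coord x \<in> S}"
  let ?l = "\<lambda>i. line_coord (axis i 1)"
  let ?d = "deriv (deriv e) (line_coord x)"
  have "partial_deriv i (partial_deriv i (\<lambda>x. Re (e (line_coord x)))) x = Re (?l i * ?l i * ?d)" for i
  proof -
    have first: "Re (?l i * deriv e (line_coord y)) = partial_deriv i (\<lambda>x. Re (e (line_coord x))) y"
      if "y \<in> {x. line_coord x \<in> S}" for y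
      using partial_deriv_Re_holomorphic[OF assms, of y i 1] that by simp
    have "((\<lambda>y. Re (?l i * deriv e (line_coord y))) has_derivative
          (\<lambda>V. Re (?l i * line_coord V * ?d))) (at x)"
      using has_derivative_Re_holomorphic[OF holomorphic_deriv[OF assms] assms(2)] x by simp
    from has_derivative_transform_within_open[OF this open_line_coord_vimage[OF assms(2)] x first]
    show ?thesis
      by (simp add: partial_deriv_def[of i "partial_deriv i _"] frechet_derivative_eqI)
  qed
  moreover have "?l 1 = 1" "?l 2 = 0" "?l 3 = \<i>"
    by (simp_all add: line_coord_def axis_def Complex_eq)
  ultimately show "(\<Sum>i\<in>UNIV. partial_deriv i (partial_deriv i (\<lambda>x. Re (e (line_coord x)))) x) = 0"
    unfolding sum_3 by (simp only: mult_1 mult_zero_left i_squared) simp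
qed

lemma bounded_linear_w_of: "bounded_linear w_of"
proof -
  have "bounded_linear (\<lambda>\<x>::(real ^ 3) ^ 'n. \<x> $ j $ k)" for j k
    by (rule bounded_linear_compose[OF bounded_linear_vec_nth bounded_linear_vec_nth])
  then show ?thesis
    unfolding w_of_def[abs_def] by (intro bounded_linear_vec_lambda bounded_linear_Complex)
qed

lemma w_of_affine:
  "w_of (\<chi> j. a $ j + (c $ j) *\<^sub>R x) = w_of a + line_coord x *s (\<chi> j. complex_of_real (c $ j))"
  by (simp add: w_of_def line_coord_def vec_eq_iff complex_eq_iff)

lemma holomorphic_cnE:
  assumes "holomorphic_cn W f" "w \<in> W"
  obtains D where "(f has_derivative D) (at w)" "\<forall>c h. D (c *s h) = c * D h"
proof -
  have "\<exists>D. (f has_derivative D) (at w) \<and> (\<forall>c h. D (c *s h) = c * D h)"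
    using assms by (simp add: holomorphic_cn_def)
  with that show thesis by blast
qed

text \<open>Restriction to a complex line turns the Laplace condition in several variables into a statement
about holomorphic functions of one variable, where derivatives of all orders exist.\<close>

lemma holomorphic_on_complex_line:
  assumes "holomorphic_cn W f"
  shows "open {t. b + t *s d \<in> W}" "(\<lambda>t. f (b + t *s d)) holomorphic_on {t. b + t *s d \<in> W}"
proof -
  have "bounded_linear (\<lambda>t::complex. \<chi> i. t * d $ i)"
    by (intro bounded_linear_vec_lambda bounded_linear_mult_left)
  then have "((\<lambda>t::complex. t *s d) has_derivative (\<lambda>t. t *s d)) (at s)" for s
    unfolding vector_scalar_mult_def by (rule bounded_linear_imp_has_derivative)
  then have line: "((\<lambda>t::complex. b + t *s d) has_derivative (\<lambda>t. t *s d)) (at s)" for s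
    using has_derivative_add[OF has_derivative_const] by fastforce
  have "continuous_on UNIV (\<lambda>t::complex. b + t *s d)"
    using has_derivative_continuous[OF line] by (simp add: continuous_at_imp_continuous_on)
  moreover have W: "open W" using assms by (simp add: holomorphic_cn_def)
  ultimately show S: "open {t. b + t *s d \<in> W}"
    using open_vimage[of W "\<lambda>t. b + t *s d"] by (simp add: vimage_def)
  have "(\<lambda>t. f (b + t *s d)) field_differentiable (at s)" if s: "b + s *s d \<in> W" for s
  proof -
    obtain D where D: "(f has_derivative D) (at (b + s *s d))" "\<forall>c h. D (c *s h) = c * D h"
      by (rule holomorphic_cnE[OF assms s])
    from has_derivative_compose[OF line D(1)]
    have "((\<lambda>t. f (b + t *s d)) has_derivative (\<lambda>t. t * D d)) (at s)"
      by (simp only: D(2)[rule_format])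
    then have "((\<lambda>t. f (b + t *s d)) has_derivative (*) (D d)) (at s)"
      by (simp only: mult.commute[of _ "D d"])
    then show ?thesis unfolding field_differentiable_def has_field_derivative_def by blast
  qed
  then show "(\<lambda>t. f (b + t *s d)) holomorphic_on {t. b + t *s d \<in> W}"
    by (simp add: holomorphic_on_def field_differentiable_at_within)
qed

lemma legendre_input_Re_holomorphic:
  assumes "holomorphic_cn W f"
  shows "legendre_input {\<x>. w_of \<x> \<in> W} (\<lambda>\<x>. Re (f (w_of \<x>)))"
  unfolding legendre_input_def
proof (intro conjI ballI allI)
  have "open W" using assms by (simp add: holomorphic_cn_def)
  from open_vimage[OF this bounded_linear.continuous_on[OF bounded_linear_w_of continuous_on_id]]
  show "open {\<x>. w_of \<x> \<in> W}" by (simp add: vimage_def)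
next
  fix \<x> assume "\<x> \<in> {\<x>. w_of \<x> \<in> W}"
  then have "w_of \<x> \<in> W" by simp
  then obtain D where "(f has_derivative D) (at (w_of \<x>))"
    by (rule holomorphic_cnE[OF assms])
  from bounded_linear.has_derivative[OF bounded_linear_Re
      has_derivative_compose[OF bounded_linear_imp_has_derivative[OF bounded_linear_w_of] this]]
  show "(\<lambda>\<x>. Re (f (w_of \<x>))) differentiable (at \<x>)" by (auto simp: differentiable_def)
next
  fix a :: "(real ^ 3) ^ 'a" and c :: "real ^ 'a"
  show "laplace3_on {x. (\<chi> j. a $ j + (c $ j) *\<^sub>R x) \<in> {\<x>. w_of \<x> \<in> W}}
          (\<lambda>x. Re (f (w_of (\<chi> j. a $ j + (c $ j) *\<^sub>R x))))"
    using laplace3_on_Re_holomorphic[OF holomorphic_on_complex_line(2,1)[OF assms]]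
    by (simp add: w_of_affine)
qed

lemma complex_linear_vec_expansion:
  fixes D :: "complex ^ 'n \<Rightarrow> complex"
  assumes "linear D" "\<And>c h. D (c *s h) = c * D h"
  shows "D h = (\<Sum>j\<in>UNIV. h $ j * D (axis j 1))"
proof -
  have "D h = D (\<Sum>j\<in>UNIV. h $ j *s axis j 1)" by (simp only: basis_expansion)
  also have "\<dots> = (\<Sum>j\<in>UNIV. h $ j * D (axis j 1))"
    by (simp add: linear_sum[OF assms(1)] assms(2))
  finally show ?thesis .
qed

lemma holomorphic_cn_has_derivative:
  assumes "holomorphic_cn W f" "w \<in> W"
  shows "(f has_derivative (\<lambda>h. \<Sum>j\<in>UNIV. h $ j * partial_deriv j f w)) (at w)"
proof -
  obtain D where D: "(f has_derivative D) (at w)" "\<forall>c h. D (c *s h) = c * D h"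
    by (rule holomorphic_cnE[OF assms])
  have "D h = (\<Sum>j\<in>UNIV. h $ j * partial_deriv j f w)" for h
    unfolding partial_deriv_def frechet_derivative_eqI[OF D(1)]
    by (rule complex_linear_vec_expansion[OF has_derivative_linear[OF D(1)] D(2)[rule_format]])
  then have "D = (\<lambda>h. \<Sum>j\<in>UNIV. h $ j * partial_deriv j f w)" by (rule ext)
  then show ?thesis using D(1) by simp
qed

section \<open>Bilinear forms given by matrices\<close>

lemma inner_matrix_vector_mult:
  fixes A :: "real ^ 'm ^ 'm"
  shows "x \<bullet> (A *v y) = (\<Sum>j\<in>UNIV. \<Sum>k\<in>UNIV. A $ j $ k * (x $ j * y $ k))"
  by (simp add: inner_vec_def matrix_vector_mult_def sum_distrib_left mult_ac)

lemma inner_transpose_mult: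
  fixes A :: "real ^ 'm ^ 'm"
  shows "x \<bullet> (transpose A *v y) = y \<bullet> (A *v x)"
  using dot_lmul_matrix[of y A x] by (simp add: inner_commute)

lemma bounded_linear_matrix_apply:
  fixes C :: "real ^ 'm"
  shows "bounded_linear (\<lambda>M :: real ^ 'm ^ 'm. M *v C)"
  unfolding linear_conv_bounded_linear[symmetric]
  by (rule linearI) (simp_all add: matrix_vector_mult_add_rdistrib scaleR_matrix_vector_assoc)

lemma matrix_vector_mult_uminus: "(A :: real ^ 'm ^ 'k) *v (- X) = - (A *v X)"
  using matrix_vector_mult_diff_distrib[of A 0 X] by simp

lemma symp_matrix_antisym: "transpose symp_matrix = - symp_matrix"
  by (auto simp: transpose_def symp_matrix_def vec_eq_iff split: sum.splits)

lemma symp_form_antisym: "x \<bullet> (symp_matrix *v y) = - (y \<bullet> (symp_matrix *v x))"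
proof -
  have "y \<bullet> (transpose symp_matrix *v x) = y \<bullet> ((0 - symp_matrix) *v x)"
    by (simp add: symp_matrix_antisym)
  then show ?thesis
    unfolding inner_transpose_mult matrix_vector_mult_diff_rdistrib by simp
qed

lemma omega1_eq:
  "omega1 \<phi> p X Y = fst X \<bullet> (hessian \<phi> (fst p) *v snd Y) - fst Y \<bullet> (hessian \<phi> (fst p) *v snd X)"
  by (simp add: omega1_def wedge_def dx_def dy_def inner_matrix_vector_mult right_diff_distrib sum_subtractf)

lemma symp_sum_wedge:
  "(\<Sum>j\<in>UNIV. \<Sum>k\<in>UNIV. symp_matrix $ j $ k * (x $ j * y $ k - y $ j * x $ k))
    = 2 * (x \<bullet> (symp_matrix *v y))"
proof -
  have "(\<Sum>j\<in>UNIV. \<Sum>k\<in>UNIV. symp_matrix $ j $ k * (x $ j * y $ k - y $ j * x $ k))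
      = x \<bullet> (symp_matrix *v y) - y \<bullet> (symp_matrix *v x)"
    unfolding inner_matrix_vector_mult by (simp add: right_diff_distrib sum_subtractf)
  then show ?thesis using symp_form_antisym[of x y] by simp
qed

lemma omega2_eq:
  "omega2 p X Y = - (fst X \<bullet> (symp_matrix *v fst Y)) + snd X \<bullet> (symp_matrix *v snd Y)"
proof -
  have "omega2 p X Y = - (1 / 2) *
      ((\<Sum>j\<in>UNIV. \<Sum>k\<in>UNIV. symp_matrix $ j $ k * (fst X $ j * fst Y $ k - fst Y $ j * fst X $ k))
     - (\<Sum>j\<in>UNIV. \<Sum>k\<in>UNIV. symp_matrix $ j $ k * (snd X $ j * snd Y $ k - snd Y $ j * snd X $ k)))"
    by (simp add: omega2_def omega23_def wedge_def dxy_def dx_def dy_def algebra_simps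
        sum.distrib sum_subtractf)
  then show ?thesis unfolding symp_sum_wedge by argo
qed

lemma omega3_eq:
  "omega3 p X Y = - (fst X \<bullet> (symp_matrix *v snd Y)) - snd X \<bullet> (symp_matrix *v fst Y)"
proof -
  have "omega3 p X Y = - (1 / 2) *
      ((\<Sum>j\<in>UNIV. \<Sum>k\<in>UNIV. symp_matrix $ j $ k * (fst X $ j * snd Y $ k - snd Y $ j * fst X $ k))
     + (\<Sum>j\<in>UNIV. \<Sum>k\<in>UNIV. symp_matrix $ j $ k * (snd X $ j * fst Y $ k - fst Y $ j * snd X $ k)))"
    by (simp add: omega3_def omega23_def wedge_def dxy_def dx_def dy_def algebra_simps
        sum.distrib sum_subtractf)
  then show ?thesis unfolding symp_sum_wedge by argo
qed

text \<open>Non-degeneracy is checked by exhibiting, for each vector, a partner \<open>J Z\<close> with which it pairs to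
something non-zero. For the three forms the partner is the image under the respective complex
structure.\<close>

lemma inj_bilinearI:
  assumes "bilinear b" "\<And>Z. Z \<noteq> 0 \<Longrightarrow> b Z (J Z) \<noteq> 0"
  shows "inj b"
proof (rule injI, rule ccontr)
  fix Z Z' assume eq: "b Z = b Z'" and "Z \<noteq> Z'"
  then have "b (Z - Z') (J (Z - Z')) \<noteq> 0" using assms(2) by simp
  then show False using eq bilinear_lsub[OF assms(1)] by simp
qed

lemma form_quotient_eqI:
  assumes "inj (a p)" "\<And>Z. a p (J Z) = b p Z"
  shows "form_quotient a b p = J"
proof
  fix Z
  show "form_quotient a b p Z = J Z"
    using inv_f_f[OF assms(1), of "J Z"] by (simp add: form_quotient_def assms(2))
qed

lemma bilinear_omega:
  "bilinear (omega1 \<phi> p)" "bilinear (omega2 p)" "bilinear (omega3 p)"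
  unfolding bilinear_def omega1_eq omega2_eq omega3_eq
  by (auto intro!: linearI simp: algebra_simps inner_simps matrix_vector_right_distrib)

lemma omega_alternating:
  "omega1 \<phi> p X X = 0" "omega2 p X X = 0" "omega3 p X X = 0"
  using symp_form_antisym[of "fst X" "fst X"] symp_form_antisym[of "snd X" "snd X"]
    symp_form_antisym[of "fst X" "snd X"]
  by (simp_all add: omega1_eq omega2_eq omega3_eq)

section \<open>The hyperkaehler structure\<close>

locale special_kaehler_potential =
  fixes U :: "(real ^ ('n::finite + 'n)) set"
    and \<phi> :: "real ^ ('n + 'n) \<Rightarrow> real"
    and I :: "real ^ ('n + 'n) \<Rightarrow> real ^ ('n + 'n) ^ ('n + 'n)"
  assumes smooth_potential: "smooth_on U \<phi>"
    and special: "special_kaehler_on U symp_matrix (hessian \<phi>) I"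
begin

lemma open_U: "open U"
  and smooth_hessian: "smooth_on U (hessian \<phi>)"
  and smooth_I: "smooth_on U I"
  using special unfolding special_kaehler_on_def by blast+

lemma open_total: "open (U \<times> (UNIV :: (real ^ ('n + 'n)) set))"
  by (rule open_Times[OF open_U open_UNIV])

lemma hessian_sym:
  assumes "x \<in> U"
  shows "X \<bullet> (hessian \<phi> x *v Y) = Y \<bullet> (hessian \<phi> x *v X)"
proof -
  have "transpose (hessian \<phi> x) = hessian \<phi> x"
    using special assms unfolding special_kaehler_on_def by blast
  then show ?thesis using inner_transpose_mult[of X "hessian \<phi> x" Y] by simp
qed

lemma hessian_pos: "x \<in> U \<Longrightarrow> X \<noteq> 0 \<Longrightarrow> X \<bullet> (hessian \<phi> x *v X) > 0"
  using special unfolding special_kaehler_on_def by blast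

lemma I_squared:
  assumes "x \<in> U"
  shows "I x *v (I x *v X) = - X"
proof -
  have "I x ** I x = - mat 1"
    using special assms unfolding special_kaehler_on_def by blast
  then have "I x ** I x = 0 - mat 1" by simp
  then show ?thesis
    by (simp only: matrix_vector_mul_assoc matrix_vector_mult_diff_rdistrib) simp
qed

lemma symp_I:
  assumes "x \<in> U"
  shows "symp_matrix *v (I x *v X) = hessian \<phi> x *v X"
proof -
  have "I x = matrix_inv symp_matrix ** hessian \<phi> x" "invertible (symp_matrix :: real ^ ('n + 'n) ^ _)"
    using special assms unfolding special_kaehler_on_def by blast+
  moreover from this(2) have "symp_matrix ** matrix_inv symp_matrix = (mat 1 :: real ^ ('n + 'n) ^ _)"
    unfolding invertible_def matrix_inv_def by (rule someI2_ex) blast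
  ultimately show ?thesis
    by (simp add: matrix_vector_mul_assoc matrix_mul_assoc)
qed

text \<open>This is \<open>g I = \<Omega> I\<^sup>2 = - \<Omega>\<close>.\<close>

lemma hessian_I: "x \<in> U \<Longrightarrow> hessian \<phi> x *v (I x *v X) = - (symp_matrix *v X)"
  using symp_I[of x "I x *v X"] by (simp add: I_squared matrix_vector_mult_uminus)

lemma derivative_hessian:
  "x \<in> U \<Longrightarrow> (hessian \<phi> has_derivative frechet_derivative (hessian \<phi>) (at x)) (at x)"
  by (rule smooth_on_has_derivative[OF smooth_hessian])

lemma derivative_I:
  "x \<in> U \<Longrightarrow> (I has_derivative frechet_derivative I (at x)) (at x)"
  by (rule smooth_on_has_derivative[OF smooth_I])

text \<open>The condition \<open>d\<^sub>\<nabla> I = 0\<close> without indices.\<close>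

lemma derivative_I_sym:
  assumes "x \<in> U"
  shows "frechet_derivative I (at x) A *v C = frechet_derivative I (at x) C *v A"
proof -
  let ?D = "frechet_derivative I (at x)"
  have "bounded_linear (\<lambda>M :: real ^ ('n + 'n) ^ ('n + 'n). M $ a $ c)" for a c
    by (rule bounded_linear_compose[OF bounded_linear_vec_nth bounded_linear_vec_nth])
  from bounded_linear.has_derivative[OF this derivative_I[OF assms]]
  have entry: "((\<lambda>y. I y $ a $ c) has_derivative (\<lambda>A. ?D A $ a $ c)) (at x)" for a c .
  have expand: "?D A $ a $ c = (\<Sum>b\<in>UNIV. A $ b * partial_deriv b (\<lambda>y. I y $ a $ c) x)" for A a c
    using frechet_derivative_eq_partial_sum[of "\<lambda>y. I y $ a $ c" x A] entry[of a c]
    by (simp add: frechet_derivative_eqI[OF entry] differentiableI)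
  have closed: "partial_deriv b (\<lambda>y. I y $ a $ c) x = partial_deriv c (\<lambda>y. I y $ a $ b) x" for a b c
    using special assms unfolding special_kaehler_on_def by blast
  have comp: "(?D A *v C) $ a =
      (\<Sum>c\<in>UNIV. \<Sum>b\<in>UNIV. A $ b * C $ c * partial_deriv b (\<lambda>y. I y $ a $ c) x)" for A C a
    by (simp add: matrix_vector_mult_def expand sum_distrib_left mult_ac)
  show ?thesis
    unfolding vec_eq_iff
  proof
    fix a
    have "(?D A *v C) $ a = (\<Sum>c\<in>UNIV. \<Sum>b\<in>UNIV. A $ b * C $ c * partial_deriv c (\<lambda>y. I y $ a $ b) x)"
      unfolding comp by (subst closed) (rule refl)
    also have "\<dots> = (\<Sum>b\<in>UNIV. \<Sum>c\<in>UNIV. C $ c * A $ b * partial_deriv c (\<lambda>y. I y $ a $ b) x)"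
      by (subst sum.swap) (simp only: mult.commute[of "A $ _"])
    also have "\<dots> = (?D C *v A) $ a" unfolding comp ..
    finally show "(?D A *v C) $ a = (?D C *v A) $ a" .
  qed
qed

lemma derivative_hessian_apply:
  assumes "x \<in> U"
  shows "((\<lambda>y. hessian \<phi> y *v C) has_derivative
    (\<lambda>A. frechet_derivative (hessian \<phi>) (at x) A *v C)) (at x)"
  by (rule bounded_linear.has_derivative[OF bounded_linear_matrix_apply derivative_hessian[OF assms]])

text \<open>The third derivatives of \<open>\<phi>\<close> are totally symmetric. Both generating transpositions come from the
special Kaehler structure: one is the symmetry of \<open>g\<close>, the other is \<open>d\<^sub>\<nabla> I = 0\<close> multiplied by the constant
matrix \<open>\<Omega>\<close>, since \<open>g = \<Omega> I\<close>.\<close>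

lemma derivative_hessian_sym:
  assumes "x \<in> U"
  shows "B \<bullet> (frechet_derivative (hessian \<phi>) (at x) A *v C)
       = A \<bullet> (frechet_derivative (hessian \<phi>) (at x) B *v C)"
proof -
  let ?D = "frechet_derivative (hessian \<phi>) (at x)"
  have pair: "((\<lambda>y. B \<bullet> (hessian \<phi> y *v C)) has_derivative (\<lambda>A. B \<bullet> (?D A *v C))) (at x)" for B C
    by (rule bounded_linear.has_derivative[OF bounded_linear_inner_right derivative_hessian_apply[OF assms]])
  have sym: "B \<bullet> (?D A *v C) = C \<bullet> (?D A *v B)" for A B C
    using has_derivative_unique[OF
        has_derivative_transform_within_open[OF pair[of B C] open_U assms hessian_sym] pair[of C B]]
    by metis
  have "((\<lambda>y. symp_matrix *v (I y *v C)) has_derivative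
        (\<lambda>A. symp_matrix *v (frechet_derivative I (at x) A *v C))) (at x)" for C
    by (intro bounded_linear.has_derivative[OF matrix_vector_mul_bounded_linear]
        bounded_linear.has_derivative[OF bounded_linear_matrix_apply] derivative_I[OF assms])
  from has_derivative_unique[OF has_derivative_transform_within_open[OF this open_U assms symp_I]
      derivative_hessian_apply[OF assms]]
  have "?D A *v C = symp_matrix *v (frechet_derivative I (at x) A *v C)" for A C by metis
  then have "?D A *v C = ?D C *v A" for A C by (simp add: derivative_I_sym[OF assms])
  then show ?thesis using sym by metis
qed

text \<open>The exterior derivative on \<open>X, Y, Z\<close> is an alternating sum of six third derivatives of \<open>\<phi>\<close>, which cancel
in pairs by total symmetry.\<close>

lemma closed_omega1: "closed_form2 (U \<times> UNIV) (omega1 \<phi>)"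
  unfolding closed_form2_def
proof (intro ballI allI)
  fix p X Y Z :: "'n phase" assume "p \<in> U \<times> UNIV"
  then have p: "fst p \<in> U" by auto
  let ?D = "frechet_derivative (hessian \<phi>) (at (fst p))"
  have "((\<lambda>q. A \<bullet> (hessian \<phi> (fst q) *v C)) has_derivative (\<lambda>X. A \<bullet> (?D (fst X) *v C))) (at p)" for A C
    using has_derivative_compose[OF bounded_linear_imp_has_derivative[OF bounded_linear_fst]
        bounded_linear.has_derivative[OF bounded_linear_inner_right derivative_hessian_apply[OF p]]] .
  from has_derivative_diff[OF this this]
  have "((\<lambda>q. omega1 \<phi> q Y Z) has_derivative
     (\<lambda>X. fst Y \<bullet> (?D (fst X) *v snd Z) - fst Z \<bullet> (?D (fst X) *v snd Y))) (at p)" for Y Z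
    unfolding omega1_eq .
  then have "frechet_derivative (\<lambda>q. omega1 \<phi> q Y Z) (at p) =
     (\<lambda>X. fst Y \<bullet> (?D (fst X) *v snd Z) - fst Z \<bullet> (?D (fst X) *v snd Y))" for Y Z
    by (rule frechet_derivative_eqI)
  then show "frechet_derivative (\<lambda>q. omega1 \<phi> q Y Z) (at p) X
      - frechet_derivative (\<lambda>q. omega1 \<phi> q X Z) (at p) Y
      + frechet_derivative (\<lambda>q. omega1 \<phi> q X Y) (at p) Z = 0"
    using derivative_hessian_sym[OF p, of "fst Y" "fst X" "snd Z"]
      derivative_hessian_sym[OF p, of "fst Z" "fst X" "snd Y"]
      derivative_hessian_sym[OF p, of "fst Z" "fst Y" "snd X"]
    by simp
qed

lemma smooth_omega1: "smooth_on (U \<times> UNIV) (\<lambda>p. omega1 \<phi> p X Y)"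
proof -
  have "bounded_linear (\<lambda>M :: real ^ ('n + 'n) ^ ('n + 'n). fst X \<bullet> (M *v snd Y) - fst Y \<bullet> (M *v snd X))"
    by (intro bounded_linear_sub bounded_linear_compose[OF bounded_linear_inner_right]
        bounded_linear_matrix_apply)
  from smooth_on_linear_image[OF this open_total
      smooth_on_compose_linear[OF bounded_linear_fst open_total open_U _ smooth_hessian]]
  show ?thesis unfolding omega1_eq by auto
qed

text \<open>\<open>J1\<close> is multiplication by \<open>\<i>\<close> on \<open>x + \<i> y\<close>. On the vectors \<open>X + \<i> Y\<close>, \<open>J2\<close> is minus the composition of
\<open>I\<close> with complex conjugation, hence anticommutes with \<open>J1\<close>, and \<open>J3\<close> is the product of the two.\<close>

definition J1 :: "'n phase \<Rightarrow> 'n phase" where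
  "J1 Z = (- snd Z, fst Z)"

definition J2 :: "'n phase \<Rightarrow> 'n phase \<Rightarrow> 'n phase" where
  "J2 p Z = (- (I (fst p) *v fst Z), I (fst p) *v snd Z)"

definition J3 :: "'n phase \<Rightarrow> 'n phase \<Rightarrow> 'n phase" where
  "J3 p Z = (- (I (fst p) *v snd Z), - (I (fst p) *v fst Z))"

definition hk_metric :: "'n phase \<Rightarrow> 'n phase \<Rightarrow> 'n phase \<Rightarrow> real" where
  "hk_metric p Z W = fst Z \<bullet> (hessian \<phi> (fst p) *v fst W) + snd Z \<bullet> (hessian \<phi> (fst p) *v snd W)"

text \<open>A single positive definite form accounts for the positivity of the metric and for the non-degeneracy of all
three symplectic forms.\<close>

lemma omega_J:
  assumes "fst p \<in> U"
  shows "omega1 \<phi> p Z (J1 W) = hk_metric p Z W"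
    and "omega2 p Z (J2 p W) = hk_metric p Z W"
    and "omega3 p Z (J3 p W) = hk_metric p Z W"
  using hessian_sym[OF assms, of "snd W" "snd Z"]
  by (simp_all add: omega1_eq omega2_eq omega3_eq J1_def J2_def J3_def hk_metric_def
      matrix_vector_mult_uminus symp_I[OF assms])

lemma hk_metric_pos:
  assumes "fst p \<in> U" "Z \<noteq> 0"
  shows "hk_metric p Z Z > 0"
proof -
  have nonneg: "X \<bullet> (hessian \<phi> (fst p) *v X) \<ge> 0" for X
    using hessian_pos[OF assms(1), of X] by (cases "X = 0") auto
  from assms(2) have "fst Z \<noteq> 0 \<or> snd Z \<noteq> 0" by (auto simp: prod_eq_iff)
  then show ?thesis
    unfolding hk_metric_def using hessian_pos[OF assms(1)] nonneg
    by (meson add_nonneg_pos add_pos_nonneg)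
qed

lemma inj_omega:
  assumes "fst p \<in> U"
  shows "inj (omega1 \<phi> p)" "inj (omega2 p)" "inj (omega3 p)"
  using hk_metric_pos[OF assms] omega_J[OF assms]
  by (intro inj_bilinearI[OF bilinear_omega(1), where J = J1] inj_bilinearI[OF bilinear_omega(2), where J = "J2 p"]
      inj_bilinearI[OF bilinear_omega(3), where J = "J3 p"]; simp add: less_imp_neq[symmetric])+

text \<open>Each \<open>J\<close> is characterised by \<open>a (J Z) = b Z\<close> as functionals, so verifying this identity suffices once
the form \<open>a\<close> is injective.\<close>

lemma form_quotients:
  assumes "fst p \<in> U"
  shows "form_quotient omega3 omega2 p = J1"
    and "form_quotient (omega1 \<phi>) omega3 p = J2 p"
    and "form_quotient omega2 (omega1 \<phi>) p = J3 p"
proof -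
  have "omega3 p (J1 Z) W = omega2 p Z W" for Z W
    by (simp add: omega2_eq omega3_eq J1_def)
  then show "form_quotient omega3 omega2 p = J1"
    by (intro form_quotient_eqI inj_omega[OF assms] ext)
  have "omega1 \<phi> p (J2 p Z) W = omega3 p Z W" for Z W
    using hessian_sym[OF assms, of "I (fst p) *v fst Z" "snd W"]
      symp_form_antisym[of "fst Z" "snd W"] symp_form_antisym[of "snd Z" "fst W"]
    by (simp add: omega1_eq omega3_eq J2_def hessian_I[OF assms])
  then show "form_quotient (omega1 \<phi>) omega3 p = J2 p"
    by (intro form_quotient_eqI inj_omega[OF assms] ext)
  have "omega2 p (J3 p Z) W = omega1 \<phi> p Z W" for Z W
    using hessian_sym[OF assms, of "snd W" "fst Z"]
      symp_form_antisym[of "I (fst p) *v snd Z" "fst W"] symp_form_antisym[of "I (fst p) *v fst Z" "snd W"]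
    by (simp add: omega1_eq omega2_eq J3_def symp_I[OF assms])
  then show "form_quotient omega2 (omega1 \<phi>) p = J3 p"
    by (intro form_quotient_eqI inj_omega[OF assms] ext)
qed

lemma hyperkaehler_total: "hyperkaehler (U \<times> UNIV) (omega1 \<phi>) omega2 omega3"
proof -
  have "symplectic_form (U \<times> UNIV) (omega1 \<phi>)"
    unfolding symplectic_form_def
    using bilinear_omega omega_alternating inj_omega smooth_omega1 closed_omega1 by auto
  moreover have "closed_form2 (U \<times> UNIV) (omega2 :: 'n phase form2)"
    "closed_form2 (U \<times> UNIV) (omega3 :: 'n phase form2)"
    by (simp_all add: closed_form2_def omega2_eq omega3_eq)
  then have "symplectic_form (U \<times> UNIV) (omega2 :: 'n phase form2)"
    "symplectic_form (U \<times> UNIV) (omega3 :: 'n phase form2)"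
    unfolding symplectic_form_def
    using bilinear_omega omega_alternating inj_omega smooth_on_const[OF open_total]
    by (auto simp: omega2_eq omega3_eq)
  moreover have "J1 \<circ> J1 = uminus" "J2 p \<circ> J2 p = uminus" "J3 p \<circ> J3 p = uminus" "J1 \<circ> J2 p = J3 p"
    if "fst p \<in> U" for p
    using I_squared[OF that]
    by (auto simp: J1_def J2_def J3_def fun_eq_iff matrix_vector_mult_uminus prod_eq_iff)
  moreover have "hk_metric p Z W = hk_metric p W Z" if "fst p \<in> U" for p Z W
    unfolding hk_metric_def using hessian_sym[OF that] by metis
  ultimately show ?thesis
    unfolding hyperkaehler_def Let_def
    by (auto simp: form_quotients omega_J hk_metric_pos)
qed

end

section \<open>The action and its moment map\<close>

lemma sum_UNIV_sum:
  "(\<Sum>a\<in>(UNIV :: ('m::finite + 'k::finite) set). f a) = (\<Sum>j\<in>UNIV. f (Inl j)) + (\<Sum>j\<in>UNIV. f (Inr j))"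
  by (simp add: UNIV_Plus_UNIV[symmetric] sum.Plus del: UNIV_Plus_UNIV)

lemma symp_matrix_mult_component:
  "(symp_matrix *v y) $ Inl j = y $ Inr j" "(symp_matrix *v y) $ Inr j = - (y $ Inl j)"
  by (simp_all add: matrix_vector_mult_def symp_matrix_def sum_UNIV_sum if_distrib[of "\<lambda>c. c * _"] cong: if_cong)

definition shift :: "real ^ 'n \<Rightarrow> real ^ ('n::finite + 'n)" where
  "shift t = (\<chi> a. case a of Inl j \<Rightarrow> t $ j | Inr j \<Rightarrow> 0)"

text \<open>The joint flow of the fields \<open>- \<partial>/\<partial>y\<^sub>j\<close>, whence the minus sign.\<close>

definition translate :: "real ^ 'n \<Rightarrow> 'n::finite phase \<Rightarrow> 'n phase" where
  "translate t p = (fst p, snd p - shift t)"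

lemma shift_linear: "shift 0 = 0" "shift (s + t) = shift s + shift t" "shift (c *\<^sub>R t) = c *\<^sub>R shift t"
  by (auto simp: shift_def vec_eq_iff split: sum.splits)

lemma shift_axis: "shift (axis j 1) = axis (Inl j) 1"
  by (auto simp: shift_def axis_def vec_eq_iff split: sum.splits)

lemma bounded_linear_translate: "bounded_linear (\<lambda>(t, p). translate t p)"
  unfolding linear_conv_bounded_linear[symmetric]
  by (rule linearI) (auto simp: translate_def shift_linear scaleR_diff_right)

lemma has_derivative_translate: "(translate t has_derivative id) (at p)"
proof -
  have "((\<lambda>p. (fst p, snd p - shift t)) has_derivative (\<lambda>X. (fst X, snd X))) (at p)"
    by (auto intro!: derivative_eq_intros)
  then show ?thesis by (simp add: translate_def[abs_def] id_def)
qed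

lemma translate_generated_by: "generated_by (N :: 'n::finite phase set) translate action_field"
  unfolding generated_by_def
proof (intro ballI allI)
  fix p :: "'n phase" and j :: 'n
  have "((\<lambda>s. (fst p, snd p - s *\<^sub>R axis (Inl j) 1)) has_vector_derivative (0, 0 - 1 *\<^sub>R axis (Inl j) 1)) (at 0)"
    by (auto intro!: derivative_eq_intros simp: has_vector_derivative_def)
  then show "((\<lambda>s. translate (s *\<^sub>R axis j 1) p) has_vector_derivative action_field j p) (at 0)"
    by (simp add: translate_def shift_linear shift_axis action_field_def)
qed

context special_kaehler_potential
begin

lemma triholomorphic_translate:
  "triholomorphic_action (U \<times> UNIV) (omega1 \<phi>) omega2 omega3 translate"
  unfolding triholomorphic_action_def
proof (intro conjI ballI allI)
  show "smooth_on (UNIV \<times> (U \<times> UNIV)) (\<lambda>(t, p). translate t p)"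
    by (rule smooth_on_bounded_linear[OF bounded_linear_translate open_Times[OF open_UNIV open_total]])
next
  fix p :: "'n phase" and t s assume "p \<in> U \<times> UNIV"
  then show "translate 0 p = p" "translate t p \<in> U \<times> UNIV"
      "translate (s + t) p = translate s (translate t p)"
    by (auto simp: translate_def shift_linear)
next
  fix p :: "'n phase" and t J assume p: "p \<in> U \<times> UNIV"
    and J: "J \<in> {form_quotient omega3 omega2, form_quotient (omega1 \<phi>) omega3, form_quotient omega2 (omega1 \<phi>)}"
  have "fst (translate t p) = fst p" by (simp add: translate_def)
  then have "J (translate t p) = J p"
    using J p by (auto simp: form_quotients J2_def[abs_def] J3_def[abs_def])
  then show "frechet_derivative (translate t) (at p) \<circ> J p = J (translate t p) \<circ> frechet_derivative (translate t) (at p)"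
    by (simp add: frechet_derivative_eqI[OF has_derivative_translate])
qed

lemma derivative_partial_potential:
  assumes "x \<in> U"
  shows "(partial_deriv a \<phi> has_derivative (\<lambda>V. V \<bullet> (hessian \<phi> x *v axis a 1))) (at x)"
proof -
  have d: "(partial_deriv a \<phi> has_derivative frechet_derivative (partial_deriv a \<phi>) (at x)) (at x)"
    by (rule smooth_on_has_derivative[OF smooth_on_partial_deriv[OF smooth_potential] assms])
  have "frechet_derivative (partial_deriv a \<phi>) (at x) V = V \<bullet> (hessian \<phi> x *v axis a 1)" for V
    using frechet_derivative_eq_partial_sum[OF differentiableI[OF d], of V]
    by (simp add: inner_vec_def hessian_def matrix_vector_mult_basis column_def)
  then have "frechet_derivative (partial_deriv a \<phi>) (at x) = (\<lambda>V. V \<bullet> (hessian \<phi> x *v axis a 1))"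
    by (rule ext)
  then show ?thesis using d by simp
qed

lemma moment_coord_component:
  "moment_coord \<phi> q $ j $ 1 = partial_deriv (Inl j) \<phi> (fst q)"
  "moment_coord \<phi> q $ j $ 2 = - (snd q $ Inr j)"
  "moment_coord \<phi> q $ j $ 3 = fst q $ Inr j"
  by (simp_all add: moment_coord_def)

lemma bounded_linear_phase_component:
  "bounded_linear (\<lambda>q :: 'n phase. fst q $ a)" "bounded_linear (\<lambda>q :: 'n phase. snd q $ a)"
  by (rule bounded_linear_compose[OF bounded_linear_vec_nth bounded_linear_fst]
      bounded_linear_compose[OF bounded_linear_vec_nth bounded_linear_snd])+

lemma smooth_moment_coord: "smooth_on (U \<times> UNIV) (moment_coord \<phi>)"
proof (rule smooth_on_componentwise[OF open_total])
  fix b :: "(real ^ 3) ^ 'n" assume "b \<in> Basis"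
  then obtain j k where b: "b = axis j (axis k 1)" by (auto simp: Basis_vec_def)
  have "smooth_on (U \<times> UNIV) (\<lambda>q. moment_coord \<phi> q $ j $ k)"
    using exhaust_3[of k]
  proof (elim disjE)
    assume "k = 1"
    moreover have "fst ` (U \<times> (UNIV :: (real ^ ('n + 'n)) set)) \<subseteq> U" by auto
    ultimately show ?thesis
      using smooth_on_compose_linear[OF bounded_linear_fst open_total open_U _
          smooth_on_partial_deriv[OF smooth_potential]]
      by (simp add: moment_coord_component)
  next
    assume "k = 2"
    then show ?thesis
      using smooth_on_bounded_linear[OF bounded_linear_minus[OF bounded_linear_phase_component(2)] open_total]
      by (simp add: moment_coord_component)
  next
    assume "k = 3"
    then show ?thesis
      using smooth_on_bounded_linear[OF bounded_linear_phase_component(1) open_total]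
      by (simp add: moment_coord_component)
  qed
  then show "smooth_on (U \<times> UNIV) (\<lambda>q. moment_coord \<phi> q \<bullet> b)"
    by (simp add: b inner_axis)
qed

text \<open>Contracting with \<open>- \<partial>/\<partial>y\<^sub>j\<close> selects from \<open>\<omega>\<^sub>1\<close> the \<open>j\<close>-th row of \<open>g\<close>, which is \<open>d\<xi>\<^sub>j\<close>, and from the constant
forms \<open>\<omega>\<^sub>2\<close> and \<open>\<omega>\<^sub>3\<close> the coordinate conjugate to \<open>j\<close>.\<close>

lemma moment_map_moment_coord:
  "hyperkaehler_moment_map (U \<times> UNIV) (omega1 \<phi>) omega2 omega3 translate action_field (moment_coord \<phi>)"
  unfolding hyperkaehler_moment_map_def
proof (intro conjI ballI allI smooth_moment_coord)
  fix p :: "'n phase" and j Y assume "p \<in> U \<times> UNIV"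
  then have p: "fst p \<in> U" by auto
  from has_derivative_compose[OF bounded_linear_imp_has_derivative[OF bounded_linear_fst]
      derivative_partial_potential[OF p, of "Inl j"]]
  have "frechet_derivative (\<lambda>q. partial_deriv (Inl j) \<phi> (fst q)) (at p) =
      (\<lambda>Y. fst Y \<bullet> (hessian \<phi> (fst p) *v axis (Inl j) 1))"
    by (rule frechet_derivative_eqI)
  then show "omega1 \<phi> p (action_field j p) Y = frechet_derivative (\<lambda>q. moment_coord \<phi> q $ j $ 1) (at p) Y"
    by (simp add: moment_coord_component omega1_eq action_field_def matrix_vector_mult_uminus)
  from bounded_linear_imp_has_derivative[OF bounded_linear_minus[OF bounded_linear_phase_component(2)]]
  have "frechet_derivative (\<lambda>q :: 'n phase. - (snd q $ Inr j)) (at p) = (\<lambda>Y. - (snd Y $ Inr j))"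
    by (rule frechet_derivative_eqI)
  then show "omega2 p (action_field j p) Y = frechet_derivative (\<lambda>q. moment_coord \<phi> q $ j $ 2) (at p) Y"
    by (simp add: moment_coord_component omega2_eq action_field_def inner_axis' symp_matrix_mult_component)
  from bounded_linear_imp_has_derivative[OF bounded_linear_phase_component(1)]
  have "frechet_derivative (\<lambda>q :: 'n phase. fst q $ Inr j) (at p) = (\<lambda>Y. fst Y $ Inr j)"
    by (rule frechet_derivative_eqI)
  then show "omega3 p (action_field j p) Y = frechet_derivative (\<lambda>q. moment_coord \<phi> q $ j $ 3) (at p) Y"
    by (simp add: moment_coord_component omega3_eq action_field_def inner_axis' symp_matrix_mult_component)
next
  fix p :: "'n phase" and t
  show "moment_coord \<phi> (translate t p) = moment_coord \<phi> p"
    by (simp add: moment_coord_def translate_def shift_def)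
qed

end

section \<open>Complex coordinates for \<open>J1\<close>\<close>

text \<open>The condition \<open>u\<^sub>j + cnj u\<^sub>j = \<partial>F/\<partial>\<xi>\<^sub>j = x\<^sub>j\<close> fixes the real part of \<open>u\<^sub>j\<close> as \<open>x\<^sub>j / 2\<close>, and holomorphy for
\<open>J1\<close> then fixes the imaginary part as \<open>y\<^sub>j / 2\<close> up to a constant.\<close>

definition flat_u :: "'n::finite phase \<Rightarrow> complex ^ 'n" where
  "flat_u p = (\<chi> j. Complex (fst p $ Inl j / 2) (snd p $ Inl j / 2))"

definition flat_z :: "'n::finite phase \<Rightarrow> complex ^ 'n" where
  "flat_z p = (\<chi> j. Complex (- (snd p $ Inr j)) (fst p $ Inr j))"

definition chart :: "'n::finite phase \<Rightarrow> complex ^ ('n + 'n)" where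
  "chart p = (\<chi> a. case a of Inl j \<Rightarrow> flat_z p $ j | Inr j \<Rightarrow> flat_u p $ j)"

text \<open>The inverse of the chart. Only \<open>x_of\<close> enters the Kaehler potential, which is invariant under all
translations in \<open>y\<close>.\<close>

definition x_of :: "complex ^ ('n::finite + 'n) \<Rightarrow> real ^ ('n + 'n)" where
  "x_of \<zeta> = (\<chi> a. case a of Inl j \<Rightarrow> 2 * Re (\<zeta> $ Inr j) | Inr j \<Rightarrow> Im (\<zeta> $ Inl j))"

definition y_of :: "complex ^ ('n::finite + 'n) \<Rightarrow> real ^ ('n + 'n)" where
  "y_of \<zeta> = (\<chi> a. case a of Inl j \<Rightarrow> 2 * Im (\<zeta> $ Inr j) | Inr j \<Rightarrow> - Re (\<zeta> $ Inl j))"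

lemma z_of_moment_coord: "z_of (moment_coord \<phi> p) = flat_z p"
  by (simp add: z_of_def moment_coord_def flat_z_def)

lemma zu_coord_eq_chart: "zu_coord (moment_coord \<phi>) flat_u = chart"
  by (rule ext) (unfold zu_coord_def chart_def z_of_moment_coord, rule refl)

lemma chart_inverse: "x_of (chart p) = fst p" "y_of (chart p) = snd p" "chart (x_of \<zeta>, y_of \<zeta>) = \<zeta>"
  by (auto simp: x_of_def y_of_def chart_def flat_u_def flat_z_def vec_eq_iff split: sum.splits)

lemma bij_chart: "bij chart"
  by (rule o_bij[of "\<lambda>\<zeta>. (x_of \<zeta>, y_of \<zeta>)"]) (simp_all add: fun_eq_iff chart_inverse)

lemma linear_chart: "linear chart"
  by (rule linearI)
    (auto simp: chart_def flat_u_def flat_z_def vec_eq_iff complex_eq_iff add_divide_distrib split: sum.splits)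

lemma bounded_linear_chart: "bounded_linear chart"
  using linear_chart by (simp add: linear_conv_bounded_linear)

lemma bounded_linear_flat: "bounded_linear flat_u" "bounded_linear flat_z"
  unfolding linear_conv_bounded_linear[symmetric]
  by (rule linearI; auto simp: flat_u_def flat_z_def vec_eq_iff complex_eq_iff add_divide_distrib)+

lemma bounded_linear_x_of: "bounded_linear x_of"
  unfolding linear_conv_bounded_linear[symmetric]
  by (rule linearI) (auto simp: x_of_def vec_eq_iff split: sum.splits)

lemma frechet_derivative_bounded_linear: "bounded_linear L \<Longrightarrow> frechet_derivative L (at p) = L"
  by (rule frechet_derivative_eqI[OF bounded_linear_imp_has_derivative])

text \<open>With \<open>du\<^sub>j = (dx\<^sub>j + i dy\<^sub>j) / 2\<close> and \<open>dz\<^sub>j = i (dx\<^sub>n\<^sub>+\<^sub>j + i dy\<^sub>n\<^sub>+\<^sub>j)\<close>, the factors \<open>2 i \<cdot> 1/2 \<cdot> i = - 1\<close> give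
the coefficient of \<open>\<omega>\<^sub>2 + i \<omega>\<^sub>3\<close>.\<close>

lemma omega23_eq_flat:
  "Complex (omega2 p Y Z) (omega3 p Y Z) =
    2 * \<i> * (\<Sum>j\<in>UNIV. wedge (\<lambda>V. flat_u V $ j) (\<lambda>V. flat_z V $ j) Y Z)"
  unfolding omega2_eq omega3_eq inner_vec_def
  by (simp add: sum_UNIV_sum symp_matrix_mult_component complex_eq_iff wedge_def flat_u_def flat_z_def
      sum_distrib_left sum_subtractf[symmetric] sum.distrib[symmetric] sum_negf[symmetric] algebra_simps)

text \<open>The chart lists the \<open>z\<^sub>j\<close>, which depend on the coordinates with index \<open>n + j\<close>, before the \<open>u\<^sub>j\<close>. Hence
entry \<open>a\<close> of the chart belongs to the flat coordinates with index \<open>swap_index a\<close>, and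
\<open>chart_coeff a\<close> is the factor that turns this entry into \<open>x + i y\<close>.\<close>

definition swap_index :: "'n + 'n \<Rightarrow> 'n + 'n" where
  "swap_index a = (case a of Inl j \<Rightarrow> Inr j | Inr j \<Rightarrow> Inl j)"

definition chart_coeff :: "'n + 'n \<Rightarrow> complex" where
  "chart_coeff a = (case a of Inl j \<Rightarrow> - \<i> | Inr j \<Rightarrow> 2)"

lemma x_of_axis:
  "x_of (axis a 1) = Re (chart_coeff a) *\<^sub>R axis (swap_index a) 1"
  "x_of (axis a \<i>) = - Im (chart_coeff a) *\<^sub>R axis (swap_index a) 1"
  by (auto simp: x_of_def chart_coeff_def swap_index_def axis_def vec_eq_iff split: sum.splits)

lemma chart_coeff_mult_chart: "chart_coeff a * chart V $ a = dxy (swap_index a) V"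
  by (auto simp: chart_coeff_def chart_def flat_u_def flat_z_def dxy_def dx_def dy_def swap_index_def complex_eq_iff split: sum.splits)

lemma bij_swap_index: "bij swap_index"
  by (rule o_bij[of swap_index]) (auto simp: fun_eq_iff swap_index_def split: sum.splits)

context special_kaehler_potential
begin

lemma open_chart_image: "open (chart ` (U \<times> UNIV))"
  by (rule open_surjective_linear_image[OF open_total linear_chart bij_is_surj[OF bij_chart]])

lemma chart_image_iff: "\<zeta> \<in> chart ` (U \<times> UNIV) \<longleftrightarrow> x_of \<zeta> \<in> U"
proof
  show "\<zeta> \<in> chart ` (U \<times> UNIV) \<Longrightarrow> x_of \<zeta> \<in> U" by (auto simp: chart_inverse)
  show "x_of \<zeta> \<in> U \<Longrightarrow> \<zeta> \<in> chart ` (U \<times> UNIV)"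
    using chart_inverse(3)[of \<zeta>] by (metis UNIV_I image_eqI mem_Sigma_iff)
qed

lemma complex_chart_chart: "complex_chart (U \<times> UNIV) (form_quotient omega3 omega2) chart"
  unfolding complex_chart_def frechet_derivative_bounded_linear[OF bounded_linear_chart]
proof (intro conjI ballI allI)
  show "smooth_on (U \<times> UNIV) chart"
    by (rule smooth_on_bounded_linear[OF bounded_linear_chart open_total])
  show "inj_on chart (U \<times> UNIV)"
    using bij_is_inj[OF bij_chart] by (rule inj_on_subset) simp
  fix p :: "'n phase" and X assume "p \<in> U \<times> UNIV"
  then show "chart (form_quotient omega3 omega2 p X) = \<i> *s chart X"
    by (auto simp: form_quotients J1_def chart_def flat_u_def flat_z_def vec_eq_iff complex_eq_iff split: sum.splits)
qed (rule open_chart_image bij_chart)+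

end

section \<open>The Legendre transform as Kaehler potential\<close>

context special_kaehler_potential
begin

text \<open>Chain rule for a function whose differential is the pullback of \<open>- d\<phi>\<close> under \<open>x_of\<close>. By
\<open>x_of_axis\<close> the directions \<open>1\<close> and \<open>\<i>\<close> in entry \<open>a\<close> go to real multiples of one basis vector, and the
Wirtinger derivatives combine these multiples into \<open>chart_coeff a\<close> or its conjugate.\<close>

lemma wirtinger_potential:
  assumes K: "\<And>\<zeta>. x_of \<zeta> \<in> U \<Longrightarrow>
      (K has_derivative (\<lambda>V. - frechet_derivative \<phi> (at (x_of \<zeta>)) (x_of V))) (at \<zeta>)"
    and \<zeta>: "x_of \<zeta> \<in> U"
  shows "wirtinger a (wirtinger_bar b (\<lambda>\<zeta>. complex_of_real (K \<zeta>))) \<zeta> =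
    - (1 / 4) * chart_coeff a * cnj (chart_coeff b) * complex_of_real (hessian \<phi> (x_of \<zeta>) $ swap_index a $ swap_index b)"
proof -
  have lin: "linear (frechet_derivative \<phi> (at x))" if "x \<in> U" for x
    by (rule has_derivative_linear[OF smooth_on_has_derivative[OF smooth_potential that]])
  have first: "wirtinger_bar b (\<lambda>\<zeta>. complex_of_real (K \<zeta>)) \<zeta> =
      - (1 / 2) * cnj (chart_coeff b) * complex_of_real (partial_deriv (swap_index b) \<phi> (x_of \<zeta>))"
    if "x_of \<zeta> \<in> U" for \<zeta>
  proof -
    have "frechet_derivative (\<lambda>\<zeta>. complex_of_real (K \<zeta>)) (at \<zeta>) =
        (\<lambda>V. complex_of_real (- frechet_derivative \<phi> (at (x_of \<zeta>)) (x_of V)))"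
      by (rule frechet_derivative_eqI[OF bounded_linear.has_derivative[OF bounded_linear_of_real K[OF that]]])
    then show ?thesis
      using linear_scale[OF lin[OF that]]
      by (simp add: wirtinger_bar_def x_of_axis partial_deriv_def complex_eq_iff linear_neg[OF lin[OF that]])
  qed
  let ?P = "partial_deriv (swap_index b) \<phi>"
  let ?D = "\<lambda>V. V \<bullet> (hessian \<phi> (x_of \<zeta>) *v axis (swap_index b) 1)"
  have "((\<lambda>\<zeta>. - (1 / 2) * cnj (chart_coeff b) * complex_of_real (?P (x_of \<zeta>))) has_derivative
      (\<lambda>V. - (1 / 2) * cnj (chart_coeff b) * complex_of_real (?D (x_of V)))) (at \<zeta>)"
    by (intro has_derivative_mult_right bounded_linear.has_derivative[OF bounded_linear_of_real]
        has_derivative_compose[OF bounded_linear_imp_has_derivative[OF bounded_linear_x_of]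
          derivative_partial_potential[OF \<zeta>]])
  from has_derivative_transform_within_open[OF this open_chart_image _ first[symmetric]]
  have "(wirtinger_bar b (\<lambda>\<zeta>. complex_of_real (K \<zeta>)) has_derivative
      (\<lambda>V. - (1 / 2) * cnj (chart_coeff b) * complex_of_real (?D (x_of V)))) (at \<zeta>)"
    using \<zeta> by (simp add: chart_image_iff)
  from frechet_derivative_eqI[OF this]
  have "wirtinger a (wirtinger_bar b (\<lambda>\<zeta>. complex_of_real (K \<zeta>))) \<zeta> =
     - (1 / 2) * cnj (chart_coeff b) * complex_of_real (?D (axis (swap_index a) 1)) * chart_coeff a / 2"
    by (simp add: wirtinger_def x_of_axis complex_eq_iff field_simps)
  also have "?D (axis (swap_index a) 1) = hessian \<phi> (x_of \<zeta>) $ swap_index a $ swap_index b"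
    by (simp add: inner_axis' matrix_vector_mult_basis column_def)
  finally show ?thesis by simp
qed

text \<open>In \<open>(dx\<^sub>j + i dy\<^sub>j) \<and> (dx\<^sub>k - i dy\<^sub>k)\<close> the terms \<open>dx\<^sub>j \<and> dx\<^sub>k\<close> and \<open>dy\<^sub>j \<and> dy\<^sub>k\<close> are killed by the
symmetric coefficients \<open>g\<^sub>j\<^sub>k\<close>, and the two mixed terms agree.\<close>

lemma sum_hessian_wedge_cnj:
  assumes "x \<in> U"
  shows "(\<Sum>j\<in>UNIV. \<Sum>k\<in>UNIV. complex_of_real (hessian \<phi> x $ j $ k) *
       wedge (dxy j) (\<lambda>V. cnj (dxy k V)) Y Z) =
    - 2 * \<i> * complex_of_real (omega1 \<phi> (x, y) Y Z)"
proof -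
  have "Re (\<Sum>j\<in>UNIV. \<Sum>k\<in>UNIV. complex_of_real (hessian \<phi> x $ j $ k) *
       wedge (dxy j) (\<lambda>V. cnj (dxy k V)) Y Z) =
      fst Y \<bullet> (hessian \<phi> x *v fst Z) + snd Y \<bullet> (hessian \<phi> x *v snd Z)
      - fst Z \<bullet> (hessian \<phi> x *v fst Y) - snd Z \<bullet> (hessian \<phi> x *v snd Y)"
    unfolding inner_matrix_vector_mult
    by (simp add: wedge_def dxy_def dx_def dy_def algebra_simps sum.distrib sum_subtractf)
  moreover have "Im (\<Sum>j\<in>UNIV. \<Sum>k\<in>UNIV. complex_of_real (hessian \<phi> x $ j $ k) *
       wedge (dxy j) (\<lambda>V. cnj (dxy k V)) Y Z) =
      snd Y \<bullet> (hessian \<phi> x *v fst Z) - fst Y \<bullet> (hessian \<phi> x *v snd Z)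
      - snd Z \<bullet> (hessian \<phi> x *v fst Y) + fst Z \<bullet> (hessian \<phi> x *v snd Y)"
    unfolding inner_matrix_vector_mult
    by (simp add: wedge_def dxy_def dx_def dy_def algebra_simps sum.distrib sum_subtractf)
  ultimately show ?thesis
    using hessian_sym[OF assms, of "fst Y" "fst Z"] hessian_sym[OF assms, of "snd Y" "snd Z"]
      hessian_sym[OF assms, of "snd Y" "fst Z"] hessian_sym[OF assms, of "snd Z" "fst Y"]
    by (simp add: complex_eq_iff omega1_eq)
qed

text \<open>The factors \<open>chart_coeff\<close> in the second derivatives cancel those in the differentials of the chart, so
the form becomes \<open>- 1/4\<close> times the sum in \<open>sum_hessian_wedge_cnj\<close> after renaming indices by
\<open>swap_index\<close>.\<close>

lemma ddbar_potential:
  assumes K: "\<And>\<zeta>. x_of \<zeta> \<in> U \<Longrightarrow>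
      (K has_derivative (\<lambda>V. - frechet_derivative \<phi> (at (x_of \<zeta>)) (x_of V))) (at \<zeta>)"
    and p: "fst p \<in> U"
  shows "complex_of_real (omega1 \<phi> p Y Z) = - 2 * \<i> * ddbar chart K p Y Z"
proof -
  let ?H = "\<lambda>j k. complex_of_real (hessian \<phi> (fst p) $ j $ k)"
  have "ddbar chart K p Y Z = (\<Sum>a\<in>UNIV. \<Sum>b\<in>UNIV. - (1 / 4) *
      (?H (swap_index a) (swap_index b) * wedge (dxy (swap_index a)) (\<lambda>V. cnj (dxy (swap_index b) V)) Y Z))"
    unfolding ddbar_def frechet_derivative_bounded_linear[OF bounded_linear_chart]
  proof (intro sum.cong refl)
    fix a b :: "'n + 'n"
    show "wirtinger a (wirtinger_bar b (\<lambda>\<zeta>. complex_of_real (K \<zeta>))) (chart p) *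
        wedge (\<lambda>V. chart V $ a) (\<lambda>V. cnj (chart V $ b)) Y Z = - (1 / 4) *
        (?H (swap_index a) (swap_index b) * wedge (dxy (swap_index a)) (\<lambda>V. cnj (dxy (swap_index b) V)) Y Z)"
      using p by (subst wirtinger_potential[OF K])
        (simp_all add: chart_inverse chart_coeff_mult_chart[symmetric] wedge_def field_simps)
  qed
  also have "\<dots> = (\<Sum>j\<in>UNIV. \<Sum>k\<in>UNIV. - (1 / 4) * (?H j k * wedge (dxy j) (\<lambda>V. cnj (dxy k V)) Y Z))"
    by (simp only: sum.reindex_bij_betw[OF bij_swap_index,
          of "\<lambda>k. - (1 / 4) * (?H _ k * wedge (dxy _) (\<lambda>V. cnj (dxy k V)) Y Z)"]
        sum.reindex_bij_betw[OF bij_swap_index,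
          of "\<lambda>j. \<Sum>k\<in>UNIV. - (1 / 4) * (?H j k * wedge (dxy j) (\<lambda>V. cnj (dxy k V)) Y Z)"])
  also have "\<dots> = - (1 / 4) * (- 2 * \<i> * complex_of_real (omega1 \<phi> (fst p, snd p) Y Z))"
    by (simp only: sum_distrib_left[symmetric] sum_hessian_wedge_cnj[OF p, of Y Z "snd p"])
  finally have ddbar: "ddbar chart K p Y Z = - (1 / 4) * (- 2 * \<i> * complex_of_real (omega1 \<phi> p Y Z))"
    by (simp only: prod.collapse)
  show ?thesis unfolding ddbar by (simp add: complex_eq_iff)
qed

end

locale special_kaehler_prepotential = special_kaehler_potential U \<phi> I
  for U :: "(real ^ ('n::finite + 'n)) set" and \<phi> I +
  fixes W :: "(complex ^ 'n) set" and \<F> :: "complex ^ 'n \<Rightarrow> complex"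
  assumes prepotential: "holomorphic_prepotential U \<phi> W \<F>"
begin

lemma holomorphic_F: "holomorphic_cn W \<F>"
  and w_coord_mem: "x \<in> U \<Longrightarrow> w_coord \<phi> x \<in> W"
  and v_coord_eq: "x \<in> U \<Longrightarrow> partial_deriv j \<F> (w_coord \<phi> x) = v_coord \<phi> x $ j"
  using prepotential by (auto simp: holomorphic_prepotential_def)

lemma has_derivative_F:
  "x \<in> U \<Longrightarrow> (\<F> has_derivative (\<lambda>h. \<Sum>j\<in>UNIV. h $ j * v_coord \<phi> x $ j)) (at (w_coord \<phi> x))"
  using holomorphic_cn_has_derivative[OF holomorphic_F w_coord_mem] by (simp add: v_coord_eq)

lemma w_of_moment_coord: "w_of (moment_coord \<phi> p) = w_coord \<phi> (fst p)"
  by (simp add: w_of_def w_coord_def moment_coord_def)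

text \<open>The derivative of \<open>\<F>\<close> in the real direction of \<open>w\<^sub>j\<close> is \<open>v\<^sub>j = x\<^sub>j + i \<xi>\<^sub>n\<^sub>+\<^sub>j\<close>.\<close>

lemma dF_dxi_moment_coord:
  assumes "fst p \<in> U"
  shows "dF_dxi (\<lambda>\<x>. Re (\<F> (w_of \<x>))) j (moment_coord \<phi> p) = fst p $ Inl j"
proof -
  have "((\<lambda>\<x>. Re (\<F> (w_of \<x>))) has_derivative
     (\<lambda>V. Re (\<Sum>j\<in>UNIV. w_of V $ j * v_coord \<phi> (fst p) $ j))) (at (moment_coord \<phi> p))"
    by (rule bounded_linear.has_derivative[OF bounded_linear_Re
          has_derivative_compose[OF bounded_linear_imp_has_derivative[OF bounded_linear_w_of]]])
      (use has_derivative_F[OF assms] in \<open>simp add: w_of_moment_coord\<close>)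
  then have "dF_dxi (\<lambda>\<x>. Re (\<F> (w_of \<x>))) j (moment_coord \<phi> p) =
     Re (\<Sum>k\<in>UNIV. w_of (axis j (axis 1 1)) $ k * v_coord \<phi> (fst p) $ k)"
    unfolding dF_dxi_def by (subst frechet_derivative_eqI) auto
  also have "(w_of (axis j (axis 1 1)) :: complex ^ 'n) = axis j 1"
    by (auto simp: w_of_def axis_def vec_eq_iff complex_eq_iff)
  also have "Re (\<Sum>k\<in>UNIV. axis j 1 $ k * v_coord \<phi> (fst p) $ k) = fst p $ Inl j"
    by (simp add: axis_def v_coord_def if_distrib[of "\<lambda>c. c * _"] cong: if_cong)
  finally show ?thesis .
qed

text \<open>The Legendre transform of \<open>F\<close> along the moment map, as a function of \<open>x\<close>.\<close>

definition base_potential :: "real ^ ('n + 'n) \<Rightarrow> real" where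
  "base_potential x = Re (\<F> (w_coord \<phi> x)) - (\<Sum>j\<in>UNIV. x $ Inl j * partial_deriv (Inl j) \<phi> x)"

text \<open>The Legendre transform differs from \<open>- \<phi>\<close> by a locally constant function, because
\<open>Re (\<Sum> v\<^sub>j dw\<^sub>j) = \<Sum> (x\<^sub>j d\<xi>\<^sub>j - \<xi>\<^sub>n\<^sub>+\<^sub>j dx\<^sub>n\<^sub>+\<^sub>j)\<close> and the terms \<open>x\<^sub>j d\<xi>\<^sub>j\<close> cancel.\<close>

lemma has_derivative_base_potential:
  assumes "x \<in> U"
  shows "(base_potential has_derivative (\<lambda>V. - frechet_derivative \<phi> (at x) V)) (at x)"
proof -
  let ?d = "\<lambda>j V. V \<bullet> (hessian \<phi> x *v axis (Inl j) 1)"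
  note d = derivative_partial_potential[OF assms]
  have comp: "((\<lambda>x. x $ a) has_derivative (\<lambda>V. V $ a)) (at x)" for a
    by (rule bounded_linear_imp_has_derivative[OF bounded_linear_vec_nth])
  have "((\<lambda>x. Complex (partial_deriv (Inl j) \<phi> x) (x $ Inr j)) has_derivative
      (\<lambda>V. Complex (?d j V) (V $ Inr j))) (at x)" for j
    unfolding Complex_eq
    by (intro has_derivative_add has_derivative_mult_right
        bounded_linear.has_derivative[OF bounded_linear_of_real] d comp)
  then have "(w_coord \<phi> has_derivative (\<lambda>V. \<chi> j. Complex (?d j V) (V $ Inr j))) (at x)"
    unfolding w_coord_def[abs_def] has_derivative_componentwise_within[of "\<lambda>x. \<chi> j. _ j x"]
    by (auto simp: Basis_vec_def inner_axis intro: bounded_linear.has_derivative[OF bounded_linear_inner_left])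
  from bounded_linear.has_derivative[OF bounded_linear_Re has_derivative_compose[OF this has_derivative_F[OF assms]]]
  have F: "((\<lambda>x. Re (\<F> (w_coord \<phi> x))) has_derivative
      (\<lambda>V. \<Sum>j\<in>UNIV. ?d j V * x $ Inl j - V $ Inr j * partial_deriv (Inr j) \<phi> x)) (at x)"
    by (simp add: v_coord_def)
  have "((\<lambda>x. \<Sum>j\<in>UNIV. x $ Inl j * partial_deriv (Inl j) \<phi> x) has_derivative
      (\<lambda>V. \<Sum>j\<in>UNIV. x $ Inl j * ?d j V + V $ Inl j * partial_deriv (Inl j) \<phi> x)) (at x)"
    by (intro has_derivative_sum has_derivative_mult comp d)
  from has_derivative_diff[OF F this]
  have "(base_potential has_derivative
      (\<lambda>V. (\<Sum>j\<in>UNIV. ?d j V * x $ Inl j - V $ Inr j * partial_deriv (Inr j) \<phi> x)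
        - (\<Sum>j\<in>UNIV. x $ Inl j * ?d j V + V $ Inl j * partial_deriv (Inl j) \<phi> x))) (at x)"
    unfolding base_potential_def[abs_def] .
  moreover have "(\<Sum>j\<in>UNIV. ?d j V * x $ Inl j - V $ Inr j * partial_deriv (Inr j) \<phi> x)
        - (\<Sum>j\<in>UNIV. x $ Inl j * ?d j V + V $ Inl j * partial_deriv (Inl j) \<phi> x)
      = - frechet_derivative \<phi> (at x) V" for V
    using frechet_derivative_eq_partial_sum[OF differentiableI[OF smooth_on_has_derivative[OF smooth_potential assms]], of V]
    by (simp add: sum_UNIV_sum sum_subtractf sum.distrib mult.commute)
  ultimately show ?thesis by simp
qed

definition kaehler_potential :: "complex ^ ('n + 'n) \<Rightarrow> real" where
  "kaehler_potential \<zeta> = base_potential (x_of \<zeta>)"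

lemma has_derivative_kaehler_potential:
  assumes "x_of \<zeta> \<in> U"
  shows "(kaehler_potential has_derivative (\<lambda>V. - frechet_derivative \<phi> (at (x_of \<zeta>)) (x_of V))) (at \<zeta>)"
  unfolding kaehler_potential_def[abs_def]
  by (rule has_derivative_compose[OF bounded_linear_imp_has_derivative[OF bounded_linear_x_of]
        has_derivative_base_potential[OF assms]])

lemma smooth_kaehler_potential: "smooth_on (chart ` (U \<times> UNIV)) kaehler_potential"
proof (rule smooth_on_derivative[OF open_chart_image])
  show "(kaehler_potential has_derivative (\<lambda>V. - frechet_derivative \<phi> (at (x_of \<zeta>)) (x_of V))) (at \<zeta>)"
    if "\<zeta> \<in> chart ` (U \<times> UNIV)" for \<zeta>
    using that has_derivative_kaehler_potential by (simp add: chart_image_iff)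
next
  fix b :: "complex ^ ('n + 'n)"
  have expand: "(\<Sum>k\<in>UNIV. - (x_of b $ k) *\<^sub>R partial_deriv k \<phi> (x_of \<zeta>)) = - frechet_derivative \<phi> (at (x_of \<zeta>)) (x_of b)"
    if "\<zeta> \<in> chart ` (U \<times> UNIV)" for \<zeta>
    using frechet_derivative_eq_partial_sum[OF differentiableI[OF smooth_on_has_derivative[OF smooth_potential]], of "x_of \<zeta>"] that
    by (simp add: chart_image_iff sum_negf)
  have "smooth_on (chart ` (U \<times> UNIV)) (\<lambda>\<zeta>. \<Sum>k\<in>UNIV. - (x_of b $ k) *\<^sub>R partial_deriv k \<phi> (x_of \<zeta>))"
    by (intro smooth_on_sum open_chart_image smooth_on_linear_image[OF bounded_linear_scaleR_right]
        smooth_on_compose_linear[OF bounded_linear_x_of open_chart_image open_U]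
        smooth_on_partial_deriv[OF smooth_potential]) (auto simp: chart_inverse)
  then show "smooth_on (chart ` (U \<times> UNIV)) (\<lambda>\<zeta>. - frechet_derivative \<phi> (at (x_of \<zeta>)) (x_of b))"
    by (rule smooth_on_cong[OF open_chart_image, rotated]) (rule expand)
qed

lemma kaehler_potential_legendre:
  "kaehler_potential (chart p) = legendre_transform (\<lambda>\<x>. Re (\<F> (w_of \<x>))) (moment_coord \<phi>) flat_u p"
  by (simp add: kaehler_potential_def base_potential_def chart_inverse legendre_transform_def
      w_of_moment_coord moment_coord_component flat_u_def)

lemma legendre_construction_prepotential:
  "legendre_construction (U \<times> UNIV) (omega1 \<phi>) omega2 omega3
     action_field (moment_coord \<phi>) {\<x>. w_of \<x> \<in> W} (\<lambda>\<x>. Re (\<F> (w_of \<x>)))"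
  unfolding legendre_construction_def
proof (intro conjI)
  show "DIM('n phase) = 4 * CARD('n)" by simp
  show "moment_coord \<phi> ` (U \<times> UNIV) \<subseteq> {\<x>. w_of \<x> \<in> W}"
    using w_coord_mem by (auto simp: w_of_moment_coord)
  show "\<exists>\<rho>. triholomorphic_action (U \<times> UNIV) (omega1 \<phi>) omega2 omega3 \<rho> \<and>
      generated_by (U \<times> UNIV) \<rho> action_field \<and>
      hyperkaehler_moment_map (U \<times> UNIV) (omega1 \<phi>) omega2 omega3 \<rho> action_field (moment_coord \<phi>)"
    using triholomorphic_translate translate_generated_by moment_map_moment_coord by blast
  let ?F = "\<lambda>\<x>. Re (\<F> (w_of \<x>))" and ?N = "U \<times> (UNIV :: (real ^ ('n + 'n)) set)"
  have "flat_u p $ j + cnj (flat_u p $ j) = complex_of_real (dF_dxi ?F j (moment_coord \<phi> p))"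
    if "p \<in> ?N" for p j
    using that by (auto simp: dF_dxi_moment_coord flat_u_def complex_eq_iff)
  moreover have "complex_of_real (omega1 \<phi> p Y Z) = - 2 * \<i> * ddbar chart kaehler_potential p Y Z"
    if "p \<in> ?N" for p Y Z
    using ddbar_potential[OF has_derivative_kaehler_potential, of p Y Z] that by (simp add: mem_Times_iff)
  ultimately show "\<exists>u. (\<forall>p\<in>?N. \<forall>j. u p $ j + cnj (u p $ j) = complex_of_real (dF_dxi ?F j (moment_coord \<phi> p))) \<and>
      complex_chart ?N (form_quotient omega3 omega2) (zu_coord (moment_coord \<phi>) u) \<and>
      (\<exists>K. smooth_on (zu_coord (moment_coord \<phi>) u ` ?N) K \<and>
        (\<forall>p\<in>?N. K (zu_coord (moment_coord \<phi>) u p) = legendre_transform ?F (moment_coord \<phi>) u p) \<and>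
        (\<forall>p\<in>?N. \<forall>Y Z. complex_of_real (omega1 \<phi> p Y Z) = - 2 * \<i> * ddbar (zu_coord (moment_coord \<phi>) u) K p Y Z)) \<and>
      (\<forall>p\<in>?N. \<forall>Y Z. Complex (omega2 p Y Z) (omega3 p Y Z) =
         2 * \<i> * (\<Sum>j\<in>UNIV. wedge (\<lambda>V. frechet_derivative u (at p) V $ j)
           (\<lambda>V. frechet_derivative (\<lambda>q. z_of (moment_coord \<phi> q)) (at p) V $ j) Y Z))"
    using complex_chart_chart smooth_kaehler_potential
    by (intro exI[of _ flat_u] conjI exI[of _ kaehler_potential] ballI allI;
        simp only: zu_coord_eq_chart z_of_moment_coord kaehler_potential_legendre omega23_eq_flat
          frechet_derivative_bounded_linear[OF bounded_linear_flat(1)]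
          frechet_derivative_bounded_linear[OF bounded_linear_flat(2)])
qed (rule open_total hyperkaehler_total legendre_input_Re_holomorphic[OF holomorphic_F])+

end

theorem proposition5:
  fixes U :: "(real ^ ('n::finite + 'n)) set"
    and \<phi> :: "real ^ ('n + 'n) \<Rightarrow> real"
    and I :: "real ^ ('n + 'n) \<Rightarrow> real ^ ('n + 'n) ^ ('n + 'n)"
    and W :: "(complex ^ 'n) set"
    and \<F> :: "complex ^ 'n \<Rightarrow> complex"
  assumes "smooth_on U \<phi>"
    and "special_kaehler_on U symp_matrix (hessian \<phi>) I"
    and "holomorphic_prepotential U \<phi> W \<F>"
  shows "legendre_construction (U \<times> UNIV) (omega1 \<phi>) omega2 omega3
           action_field (moment_coord \<phi>) {\<x>. w_of \<x> \<in> W} (\<lambda>\<x>. Re (\<F> (w_of \<x>)))"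
proof -
  interpret special_kaehler_prepotential U \<phi> I W \<F>
    using assms by unfold_locales
  show ?thesis by (rule legendre_construction_prepotential)
qed

end
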